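(* Let $\mathcal{T}_2$ denote the family of partial $2$-trees. Then (i) $14\le \chi_{0,3}(\mathcal{T}_2)\le 15$, and (ii) $14\le \chi_{1,1}(\mathcal{T}_2)\le 21$.
   Context: All graphs are finite. Partial $2$-trees are the simple graphs of treewidth at most $2$ (equivalently, $K_4$-minor-free graphs). An $(n,m)$-graph $G$ is a graph with $n$ types of arcs (labeled $2,4,\ldots,2n$) and $m$ types of edges (labeled $2n+1,\ldots,2n+m$), whose underlying undirected graph $\mathrm{und}(G)$ is simple (so each adjacent pair of distinct vertices is joined by exactly one arc or exactly one edge, with exactly one type, and there are no loops). Thus a $(0,3)$-graph is a simple graph with edges colored by three colors, and in a $(1,1)$-graph each adjacency is either an arc or an undirected edge. A homomorphism of an $(n,m)$-graph $G$ to an $(n,m)$-graph $H$ is a map $f:V(G)\to V(H)$ such that whenever $uv$ is an arc from $u$ to $v$ (resp. an edge) of type $\alpha$ in $G$, $f(u)f(v)$ is an arc from $f(u)$ to $f(v)$ (resp. an edge) of type $\alpha$ in $H$; write $G\to H$ if one exists. For an $(n,m)$-graph $G$, $\chi_{n,m}(G)=\min\{|V(H)|: H \text{ an } (n,m)\text{-graph},\ G\to H\}$. For a simple graph $S$, $\chi_{n,m}(S)=\max\{\chi_{n,m}(G): \mathrm{und}(G)=S\}$. For a family $\mathcal{F}$ of graphs, $\chi_{n,m}(\mathcal{F})=\max\{\chi_{n,m}(G): G\in\mathcal{F}\}$. *)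

theory Defs
  imports "Graph_Theory.Graph_Theory" "HOL-Library.Extended_Nat"
begin

text \<open>
  Finite simple graphs are the symmetric loop-free finite digraphs \<open>pair_graph\<close> of
  \<open>Graph_Theory\<close>: an undirected edge joining \<open>u\<close> and \<open>v\<close> is the pair of arcs \<open>(u, v)\<close>, \<open>(v, u)\<close>.
  Since all graphs are finite, families of graphs, target graphs of homomorphisms and trees of
  tree decompositions are taken over the vertex type \<^typ>\<open>nat\<close>, on which every finite graph
  has an isomorphic copy.
\<close>


section \<open>Treewidth and partial 2-trees\<close>

text \<open>
  The library's \<open>forest\<close> and \<open>tree\<close> forbid directed cycles, including the 2-cycles
  \<open>u, v, u\<close> that every edge of a symmetric digraph yields, so they do not express undirected
  acyclicity. Here a cycle is a path on at least three vertices whose ends are adjacent.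
\<close>

definition acyclic_graph :: "'a pair_pre_digraph \<Rightarrow> bool" where
  "acyclic_graph T \<longleftrightarrow>
     \<not> (\<exists>c. vpath c (with_proj T) \<and> length c \<ge> 3 \<and> (last c, hd c) \<in> parcs T)"

definition tree_graph :: "'a pair_pre_digraph \<Rightarrow> bool" where
  "tree_graph T \<longleftrightarrow>
     pair_graph T \<and> Digraph_Component.connected (with_proj T) \<and> acyclic_graph T"

definition tree_decomposition ::
    "'a pair_pre_digraph \<Rightarrow> 'b pair_pre_digraph \<Rightarrow> ('b \<Rightarrow> 'a set) \<Rightarrow> bool" where
  "tree_decomposition S T B \<longleftrightarrow>
     tree_graph T \<and>
     (\<Union>t\<in>pverts T. B t) = pverts S \<and>
     (\<forall>(u, v)\<in>parcs S. \<exists>t\<in>pverts T. u \<in> B t \<and> v \<in> B t) \<and>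
     (\<forall>v\<in>pverts S. Digraph_Component.connected (with_proj T \<restriction> {t \<in> pverts T. v \<in> B t}))"

text \<open>
  Subtraction is truncated, so the graph without vertices gets treewidth \<open>0\<close> instead of the
  customary \<open>-1\<close>.
\<close>

definition decomposition_width :: "'b pair_pre_digraph \<Rightarrow> ('b \<Rightarrow> 'a set) \<Rightarrow> nat" where
  "decomposition_width T B = Max ((\<lambda>t. card (B t)) ` pverts T) - 1"

definition treewidth :: "'a pair_pre_digraph \<Rightarrow> nat" where
  "treewidth S =
     (LEAST w. \<exists>(T :: nat pair_pre_digraph) B.
        tree_decomposition S T B \<and> w = decomposition_width T B)"

definition partial_2_trees :: "nat pair_pre_digraph set" where
  "partial_2_trees = {S. pair_graph S \<and> treewidth S \<le> 2}"


section \<open>\<open>(n,m)\<close>-graphs\<close>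

text \<open>
  \<open>(u, v) \<in> nm_adj G \<alpha>\<close> means that \<open>uv\<close> is an arc from \<open>u\<close> to \<open>v\<close> of type \<open>\<alpha>\<close>, if \<open>\<alpha>\<close> is
  one of the arc types \<open>2, 4, \<dots>, 2n\<close>, and that \<open>uv\<close> is an edge of type \<open>\<alpha>\<close>, if \<open>\<alpha>\<close> is one of
  the edge types \<open>2n+1, \<dots>, 2n+m\<close>. In the latter case the relation is symmetric.
\<close>

record 'a nm_graph =
  nm_verts :: "'a set"
  nm_adj :: "nat \<Rightarrow> 'a rel"

definition arc_types :: "nat \<Rightarrow> nat set" where
  "arc_types n = {2 * i | i. 1 \<le> i \<and> i \<le> n}"

definition edge_types :: "nat \<Rightarrow> nat \<Rightarrow> nat set" where
  "edge_types n m = {2 * n + 1 .. 2 * n + m}"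

text \<open>
  The last two conditions say that no two vertices are joined more than once: neither by two
  opposite arcs of the same type nor by arcs or edges of different types.
\<close>

definition is_nm_graph :: "nat \<Rightarrow> nat \<Rightarrow> 'a nm_graph \<Rightarrow> bool" where
  "is_nm_graph n m G \<longleftrightarrow>
     finite (nm_verts G) \<and>
     (\<forall>\<alpha>. nm_adj G \<alpha> \<subseteq> nm_verts G \<times> nm_verts G) \<and>
     (\<forall>\<alpha>. \<alpha> \<notin> arc_types n \<union> edge_types n m \<longrightarrow> nm_adj G \<alpha> = {}) \<and>
     (\<forall>\<alpha>. irrefl (nm_adj G \<alpha>)) \<and>
     (\<forall>\<alpha>\<in>edge_types n m. sym (nm_adj G \<alpha>)) \<and>
     (\<forall>\<alpha>\<in>arc_types n. asym (nm_adj G \<alpha>)) \<and>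
     (\<forall>\<alpha> \<beta>. \<alpha> \<noteq> \<beta> \<longrightarrow> nm_adj G \<alpha> \<inter> (nm_adj G \<beta> \<union> (nm_adj G \<beta>)\<inverse>) = {})"

definition und :: "'a nm_graph \<Rightarrow> 'a pair_pre_digraph" where
  "und G = \<lparr> pverts = nm_verts G, parcs = (\<Union>\<alpha>. nm_adj G \<alpha> \<union> (nm_adj G \<alpha>)\<inverse>) \<rparr>"

lemma pair_graph_und:
  assumes "is_nm_graph n m G"
  shows "pair_graph (und G)"
proof -
  have sub: "parcs (und G) \<subseteq> nm_verts G \<times> nm_verts G" and fin: "finite (nm_verts G)"
    using assms by (auto simp: is_nm_graph_def und_def)
  have "finite (parcs (und G))"
    using finite_subset[OF sub] fin by simp
  moreover have "symmetric (with_proj (und G))"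
    by (auto simp: symmetric_def und_def intro!: symI)
  moreover have "fst e \<noteq> snd e" if "e \<in> parcs (und G)" for e
    using assms that by (cases e) (auto simp: is_nm_graph_def und_def irrefl_def)
  moreover have "pverts (und G) = nm_verts G"
    by (simp add: und_def)
  ultimately show ?thesis
    using sub fin by unfold_locales auto
qed

definition nm_hom :: "'a nm_graph \<Rightarrow> 'b nm_graph \<Rightarrow> ('a \<Rightarrow> 'b) \<Rightarrow> bool" where
  "nm_hom G H f \<longleftrightarrow>
     f ` nm_verts G \<subseteq> nm_verts H \<and>
     (\<forall>\<alpha>. \<forall>(u, v)\<in>nm_adj G \<alpha>. (f u, f v) \<in> nm_adj H \<alpha>)"


section \<open>Chromatic numbers\<close>

definition chi :: "nat \<Rightarrow> nat \<Rightarrow> 'a nm_graph \<Rightarrow> nat" where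
  "chi n m G =
     (LEAST k. \<exists>H :: nat nm_graph. is_nm_graph n m H \<and> (\<exists>f. nm_hom G H f) \<and> card (nm_verts H) = k)"

text \<open>
  The maxima are suprema in \<^typ>\<open>enat\<close>. A finite supremum of a nonempty set in \<^typ>\<open>enat\<close> is
  attained, hence a maximum, and an unbounded family has the value \<open>\<infinity>\<close>.
\<close>

definition chi_simple :: "nat \<Rightarrow> nat \<Rightarrow> 'a pair_pre_digraph \<Rightarrow> enat" where
  "chi_simple n m S = (SUP G\<in>{G. is_nm_graph n m G \<and> und G = S}. enat (chi n m G))"

definition chi_family :: "nat \<Rightarrow> nat \<Rightarrow> 'a pair_pre_digraph set \<Rightarrow> enat" where
  "chi_family n m F = (SUP S\<in>F. chi_simple n m S)"

end

theory Submission
  imports Defs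
begin

text \<open>
  Upper bounds. A target graph in which every adjacent pair \<open>x, y\<close> has, for every pair of adjacency
  types \<open>a, b\<close>, a common neighbour \<open>w\<close> that is joined to \<open>x\<close> by \<open>a\<close> and to \<open>y\<close> by \<open>b\<close> receives every
  coloured partial 2-tree: complete the bags of a tree decomposition of width 2 to cliques and map
  them one after the other along the tree, since a new bag meets the earlier ones inside a single
  neighbouring bag. For three edge colours the 15 nonzero vectors of \<open>GF(4)\<^sup>2\<close>, coloured by the
  determinant, are such a target; for arcs and edges a Cayley graph of the nonabelian group of
  order 21 is one.

  Lower bounds. In the 2-tree built by stacking all possible triangles on all edges, to a depth
  beyond the number of edges of the target, a homomorphism produces a nonempty set of edges of the
  target that is closed under finding such triangles. With \<open>k\<close> adjacency types, each vertex \<open>x\<close> on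
  such an edge has at least \<open>k + 1\<close> neighbours of each type, because a neighbour of type \<open>a\<close> has
  itself neighbours of all \<open>k\<close> types among the neighbours of type \<open>a\<close> of \<open>x\<close>. So there are at least
  \<open>k (k + 1) + 1 = 13\<close> vertices. If there are 13, each of them lies in 4 ordered monochromatic
  triangles of an undirected type as their first vertex, but \<open>13 \<cdot> 4\<close> is not divisible by 3.
\<close>


section \<open>Tree decompositions\<close>

lemma rtrancl_on_eq_rtrancl:
  assumes "r \<subseteq> F \<times> F" "a \<in> F"
  shows "(a, b) \<in> rtrancl_on F r \<longleftrightarrow> (a, b) \<in> r\<^sup>*"
proof
  assume "(a, b) \<in> rtrancl_on F r"
  then show "(a, b) \<in> r\<^sup>*"
    by induct (auto intro: rtrancl.rtrancl_into_rtrancl)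
next
  assume "(a, b) \<in> r\<^sup>*"
  then show "(a, b) \<in> rtrancl_on F r"
    by induct (use assms in \<open>auto intro: rtrancl_on.intros\<close>)
qed

text \<open>For symmetric graphs this is the library's connectedness of the subgraph induced on
  \<open>X\<close>, as \<open>connected_induce_iff\<close> shows; it likewise excludes the empty
  set.\<close>

definition connected_in :: "'a rel \<Rightarrow> 'a set \<Rightarrow> bool" where
  "connected_in E X \<longleftrightarrow> X \<noteq> {} \<and> (\<forall>u\<in>X. \<forall>v\<in>X. (u, v) \<in> (Restr E X)\<^sup>*)"

lemma connected_inD: "connected_in E X \<Longrightarrow> u \<in> X \<Longrightarrow> v \<in> X \<Longrightarrow> (u, v) \<in> (Restr E X)\<^sup>*"
  by (simp add: connected_in_def)

lemma connected_in_singleton: "connected_in E {x}"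
  by (simp add: connected_in_def)

lemma connected_in_insert:
  assumes "connected_in E X" "s \<in> X" "(s, t) \<in> E" "(t, s) \<in> E"
  shows "connected_in E (insert t X)"
proof -
  let ?R = "Restr E (insert t X)"
  have sub: "(Restr E X)\<^sup>* \<subseteq> ?R\<^sup>*"
    by (rule rtrancl_mono) auto
  have to_s: "(u, s) \<in> ?R\<^sup>*" if "u \<in> insert t X" for u
  proof (cases "u \<in> X")
    case True
    then show ?thesis
      using connected_inD[OF assms(1) True assms(2)] sub by blast
  next
    case False
    then show ?thesis
      using that assms by (auto intro!: r_into_rtrancl)
  qed
  have from_s: "(s, v) \<in> ?R\<^sup>*" if "v \<in> insert t X" for v
  proof (cases "v \<in> X")
    case True
    then show ?thesis
      using connected_inD[OF assms(1) assms(2) True] sub by blast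
  next
    case False
    then show ?thesis
      using that assms by (auto intro!: r_into_rtrancl)
  qed
  show ?thesis
    unfolding connected_in_def using to_s from_s by (meson insert_not_empty rtrancl_trans)
qed

lemma connected_in_cong: "Restr E X = Restr E' X \<Longrightarrow> connected_in E X \<longleftrightarrow> connected_in E' X"
  by (simp add: connected_in_def)

text \<open>A walk from \<open>X\<close> to its complement has a first step out of \<open>X\<close>.
  This finds the next bag when a map is extended along a tree.\<close>

lemma connected_in_exit:
  assumes "connected_in E V" "X \<subseteq> V" "X \<noteq> {}" "X \<noteq> V"
  obtains s t where "s \<in> X" "t \<in> V - X" "(s, t) \<in> E"
proof -
  obtain a b where ab: "a \<in> X" "b \<in> V - X"
    using assms by blast
  then have "(a, b) \<in> (Restr E V)\<^sup>*"
    using assms connected_inD by fastforce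
  then have "\<exists>s\<in>X. \<exists>t\<in>V - X. (s, t) \<in> E" if "b \<in> V - X"
    using that
  proof induct
    case base
    then show ?case using ab by blast
  next
    case (step y z)
    then show ?case by (cases "y \<in> X") auto
  qed
  then show ?thesis
    using ab that by blast
qed

section \<open>Symmetric digraphs and trees\<close>

lemma pair_graph_iff:
  "pair_graph G \<longleftrightarrow> finite (pverts G) \<and> parcs G \<subseteq> pverts G \<times> pverts G \<and> sym (parcs G) \<and> irrefl (parcs G)"
  (is "?L \<longleftrightarrow> ?R")
proof
  assume ?L
  then interpret pair_graph G .
  have "parcs G \<subseteq> pverts G \<times> pverts G"
    using in_arcsD1 in_arcsD2 by auto
  moreover have "sym (parcs G)"
    using pair_sym_arcs by (simp add: symmetric_def)
  moreover have "irrefl (parcs G)"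
    using pair_no_loops by (fastforce simp: irrefl_def)
  ultimately show ?R
    using pair_finite_verts by simp
next
  assume R: ?R
  moreover have "finite (parcs G)"
    using R by (meson finite_SigmaI finite_subset)
  ultimately show ?L
    by unfold_locales (auto simp: symmetric_def irrefl_def)
qed

lemma connected_induce_iff:
  assumes "pair_graph T"
  shows "Digraph_Component.connected (with_proj T \<restriction> X) \<longleftrightarrow> connected_in (parcs T) X"
proof -
  have "parcs (mk_symmetric (with_proj T \<restriction> X)) = Restr (parcs T) X"
    using assms by (auto simp: mk_symmetric_def pair_graph_iff dest: symD)
  moreover have "pverts (mk_symmetric (with_proj T \<restriction> X)) = X"
    by (simp add: mk_symmetric_def)
  ultimately show ?thesis
    by (simp add: Digraph_Component.connected_def strongly_connected_def reachable_def
        connected_in_def rtrancl_on_eq_rtrancl cong: ball_cong)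
qed

lemma connected_iff:
  assumes "pair_graph T"
  shows "Digraph_Component.connected (with_proj T) \<longleftrightarrow> connected_in (parcs T) (pverts T)"
proof -
  have "with_proj T \<restriction> pverts T = with_proj T"
    using assms by (auto simp: induce_subgraph_def with_proj_def pair_graph_iff)
  then show ?thesis
    using connected_induce_iff[OF assms, of "pverts T"] by simp
qed

text \<open>A walk from \<open>t\<close> to \<open>s\<close> avoiding the edge shortens to a path.
  With at least three vertices, such a path is closed to a cycle by the edge itself.\<close>

lemma acyclic_graph_no_detour:
  assumes T: "pair_graph T" "acyclic_graph T" and e: "(s, t) \<in> parcs T"
  shows "(t, s) \<notin> (parcs T - {(s, t), (t, s)})\<^sup>*"
proof
  let ?E = "parcs T - {(s, t), (t, s)}"
  let ?D = "\<lparr> pverts = pverts T, parcs = ?E \<rparr>"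
  assume detour: "(t, s) \<in> ?E\<^sup>*"
  have sub: "?E \<subseteq> pverts T \<times> pverts T" "t \<in> pverts T" and "s \<noteq> t"
    using T e by (auto simp: pair_graph_iff irrefl_def)
  interpret D: pair_wf_digraph ?D
    using sub(1) by unfold_locales auto
  have "t \<rightarrow>\<^sup>*\<^bsub>with_proj ?D\<^esub> s"
    using rtrancl_on_eq_rtrancl[OF sub] detour by (simp add: reachable_def)
  then obtain p where p: "vpath p (with_proj ?D)" "hd p = t" "last p = s"
    using D.reachable_vpath_conv by auto
  then have "p \<noteq> []" and arcs: "set (vwalk_arcs p) \<subseteq> ?E"
    by (auto simp: vpath_def vwalk_def)
  then obtain q where q: "p = t # q"
    using p by (cases p) auto
  \<comment> \<open>One vertex would give \<open>s = t\<close>, and two vertices would use the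
    deleted arc from \<open>t\<close> to \<open>s\<close>.\<close>
  have "length p \<ge> 3"
  proof (rule ccontr)
    assume "\<not> length p \<ge> 3"
    then consider "q = []" | x where "q = [x]"
      using q by (cases q; cases "tl q") auto
    then show False
      by cases (use p q arcs \<open>s \<noteq> t\<close> in auto)
  qed
  moreover have "vpath p (with_proj T)"
    using p by (auto simp: vpath_def vwalk_def)
  ultimately show False
    using T(2) p e by (auto simp: acyclic_graph_def)
qed

lemma tree_graph_iff:
  "tree_graph T \<longleftrightarrow> pair_graph T \<and> connected_in (parcs T) (pverts T) \<and> acyclic_graph T"
  using connected_iff by (auto simp: tree_graph_def)

lemma tree_graph_singleton: "tree_graph \<lparr> pverts = {t}, parcs = {} \<rparr>"
  by (auto simp: tree_graph_iff pair_graph_iff connected_in_singleton acyclic_graph_def sym_def irrefl_def)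

lemma vwalk_arcs_append_Cons:
  "xs \<noteq> [] \<Longrightarrow> set (vwalk_arcs (xs @ y # ys)) = set (vwalk_arcs xs) \<union> {(last xs, y)} \<union> set (vwalk_arcs (y # ys))"
  by (induct xs rule: vwalk_arcs.induct) auto

text \<open>The only neighbour of \<open>l\<close> is \<open>t\<close>, so a cycle through
  \<open>l\<close> would visit \<open>t\<close> on both sides of it; a cycle avoiding
  \<open>l\<close> already lies in \<open>T\<close>.\<close>

lemma tree_graph_add_leaf:
  assumes T: "tree_graph T" and t: "t \<in> pverts T" "l \<notin> pverts T"
  shows "tree_graph \<lparr> pverts = insert l (pverts T), parcs = {(t, l), (l, t)} \<union> parcs T \<rparr>"
    (is "tree_graph ?T")
proof -
  have pg: "pair_graph T" and con: "connected_in (parcs T) (pverts T)" and acyc: "acyclic_graph T"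
    using T by (auto simp: tree_graph_iff)
  have sub: "parcs T \<subseteq> pverts T \<times> pverts T"
    using pg by (simp add: pair_graph_iff)
  have "pair_graph ?T"
    using pg t by (auto simp: pair_graph_iff sym_def irrefl_def)
  moreover have "Restr (parcs ?T) (pverts T) = Restr (parcs T) (pverts T)"
    using t by auto
  then have "connected_in (parcs ?T) (pverts T)"
    using con connected_in_cong by blast
  then have "connected_in (parcs ?T) (insert l (pverts T))"
    by (rule connected_in_insert[OF _ t(1)]) auto
  moreover have "acyclic_graph ?T"
    unfolding acyclic_graph_def
  proof clarify
    fix c
    assume c: "vpath c (with_proj ?T)" "3 \<le> length c" and closed: "(last c, hd c) \<in> parcs ?T"
    have arcs: "set (vwalk_arcs c) \<subseteq> parcs ?T" and dist: "distinct c"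
      using c by (auto simp: vpath_def vwalk_def)
    have nb: "x = t" if "(x, l) \<in> parcs ?T \<or> (l, x) \<in> parcs ?T" for x
      using that sub t by auto
    have "l \<notin> set c"
    proof
      assume "l \<in> set c"
      then obtain xs ys where split: "c = xs @ l # ys"
        by (meson split_list)
      have pre: "last xs = t" if "xs \<noteq> []"
        using arcs vwalk_arcs_append_Cons[OF that, of l ys] split by (intro nb) auto
      have suc: "hd ys = t" if "ys \<noteq> []"
      proof -
        obtain y zs where "ys = y # zs"
          using \<open>ys \<noteq> []\<close> by (cases ys) auto
        moreover from this have "(l, y) \<in> set (vwalk_arcs c)"
          using vwalk_arcs_append_Cons[of xs l ys] split by (cases "xs = []") auto
        then have "y = t"
          using arcs by (intro nb) blast
        ultimately show ?thesis
          by simp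
      qed
      \<comment> \<open>If \<open>l\<close> is at one end of the list, its second neighbour on the
        cycle is the vertex at the other end, reached by the closing arc. That vertex is again
        \<open>t\<close>, contradicting distinctness since the cycle has at least three
        vertices.\<close>
      show False
      proof (cases "xs = [] \<or> ys = []")
        case True
        then consider "xs = []" "ys \<noteq> []" "tl ys \<noteq> []" | "ys = []" "xs \<noteq> []" "butlast xs \<noteq> []"
          using c(2) split by (cases ys; cases xs rule: rev_cases) (auto simp: Suc_le_eq)
        then show False
        proof cases
          case 1
          then have "last ys = t"
            using closed split by (intro nb) auto
          then show False
            using 1 suc dist split by (cases ys) auto
        next
          case 2
          then have "hd xs = t"
            using closed split by (intro nb) auto
          then show False
            using 2 pre dist split by (cases xs) (auto split: if_splits)
        qed
      next
        case False
        then have "t \<in> set xs" "t \<in> set ys"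
          using pre suc last_in_set hd_in_set by metis+
        then show False
          using dist split by auto
      qed
    qed
    moreover have "set (vwalk_arcs c) \<subseteq> set c \<times> set c"
      by (auto elim: in_set_vwalk_arcsE)
    ultimately have "set (vwalk_arcs c) \<subseteq> parcs T"
      using arcs by fastforce
    moreover have "c \<noteq> []" "set c \<subseteq> pverts T"
      using c \<open>l \<notin> set c\<close> by (auto simp: vpath_def vwalk_def)
    moreover have "hd c \<in> set c" "last c \<in> set c"
      using \<open>c \<noteq> []\<close> by auto
    then have "(last c, hd c) \<in> parcs T"
      using closed \<open>l \<notin> set c\<close> by auto
    ultimately show False
      using acyc c dist by (auto simp: acyclic_graph_def vpath_def vwalk_def)
  qed
  ultimately show ?thesis
    by (simp add: tree_graph_iff)
qed

section \<open>Constructing tree decompositions\<close>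

lemma tree_decomposition_iff:
  "tree_decomposition S T B \<longleftrightarrow>
     tree_graph T \<and> (\<Union>t\<in>pverts T. B t) = pverts S \<and>
     (\<forall>(u, v)\<in>parcs S. \<exists>t\<in>pverts T. u \<in> B t \<and> v \<in> B t) \<and>
     (\<forall>v\<in>pverts S. connected_in (parcs T) {t \<in> pverts T. v \<in> B t})"
  by (simp add: tree_decomposition_def tree_graph_def connected_induce_iff cong: conj_cong)

lemma tree_decomposition_singleton:
  assumes "pair_graph S"
  shows "tree_decomposition S \<lparr> pverts = {t}, parcs = {} \<rparr> (\<lambda>_. pverts S)"
  using assms tree_graph_singleton
  by (auto simp: tree_decomposition_iff connected_in_def pair_graph_iff)

text \<open>Some bag contains the edge \<open>uv\<close>; a leaf with bag \<open>{u, v, w}\<close>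
  is hung on its node \<open>t\<close>.\<close>

lemma tree_decomposition_add_triangle:
  assumes td: "tree_decomposition S T B" and S: "pair_graph S"
    and uv: "(u, v) \<in> parcs S" and w: "w \<notin> pverts S" and l: "l \<notin> pverts T"
  obtains t where
    "tree_decomposition
       \<lparr> pverts = insert w (pverts S), parcs = {(u, w), (w, u), (v, w), (w, v)} \<union> parcs S \<rparr>
       \<lparr> pverts = insert l (pverts T), parcs = {(t, l), (l, t)} \<union> parcs T \<rparr>
       (B(l := {u, v, w}))"
proof -
  have tree: "tree_graph T" and bags: "(\<Union>t\<in>pverts T. B t) = pverts S"
    and edges: "\<forall>(u, v)\<in>parcs S. \<exists>t\<in>pverts T. u \<in> B t \<and> v \<in> B t"
    and con: "\<And>x. x \<in> pverts S \<Longrightarrow> connected_in (parcs T) {t \<in> pverts T. x \<in> B t}"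
    using td by (auto simp: tree_decomposition_iff)
  obtain t where t: "t \<in> pverts T" "u \<in> B t" "v \<in> B t"
    using edges uv by blast
  let ?E = "{(t, l), (l, t)} \<union> parcs T" and ?B = "B(l := {u, v, w})"
  have uvS: "u \<in> pverts S" "v \<in> pverts S"
    using S uv by (auto simp: pair_graph_iff)
  \<comment> \<open>The nodes holding \<open>w\<close> are just \<open>l\<close>; those holding
    \<open>u\<close> or \<open>v\<close> gain \<open>l\<close>, which is adjacent to
    \<open>t\<close>; those of every other vertex stay the same.\<close>
  have sub: "connected_in ?E {r \<in> insert l (pverts T). x \<in> ?B r}" if x: "x \<in> insert w (pverts S)" for x
  proof (cases "x = w")
    case True
    then have "{r \<in> insert l (pverts T). x \<in> ?B r} = {l}"
      using bags w by auto
    then show ?thesis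
      by (simp add: connected_in_singleton)
  next
    case False
    let ?X = "{r \<in> pverts T. x \<in> B r}"
    have "Restr ?E ?X = Restr (parcs T) ?X"
      using l by auto
    then have X: "connected_in ?E ?X"
      using con x False connected_in_cong by blast
    show ?thesis
    proof (cases "x = u \<or> x = v")
      case True
      then have "{r \<in> insert l (pverts T). x \<in> ?B r} = insert l ?X" "t \<in> ?X"
        using l t by auto
      then show ?thesis
        using connected_in_insert[OF X] by simp
    next
      case False
      then have "{r \<in> insert l (pverts T). x \<in> ?B r} = ?X"
        using l \<open>x \<noteq> w\<close> by auto
      then show ?thesis
        using X by simp
    qed
  qed
  have cover: "(\<Union>r\<in>insert l (pverts T). ?B r) = insert w (pverts S)"
    using bags l uvS by (auto split: if_splits)
  have edge: "\<exists>r\<in>insert l (pverts T). x \<in> ?B r \<and> y \<in> ?B r"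
    if "(x, y) \<in> {(u, w), (w, u), (v, w), (w, v)} \<union> parcs S" for x y
  proof (cases "(x, y) \<in> parcs S")
    case True
    then obtain r where "r \<in> pverts T" "x \<in> B r" "y \<in> B r"
      using edges by blast
    then show ?thesis
      using l by (intro bexI[where x = r]) auto
  next
    case False
    then show ?thesis
      using that by auto
  qed
  show ?thesis
  proof (rule that[of t], unfold tree_decomposition_iff pair_pre_digraph.select_convs, intro conjI)
    show "\<forall>x\<in>insert w (pverts S). connected_in ?E {r \<in> insert l (pverts T). x \<in> ?B r}"
      by (intro ballI sub)
    show "\<forall>(x, y)\<in>{(u, w), (w, u), (v, w), (w, v)} \<union> parcs S. \<exists>r\<in>insert l (pverts T). x \<in> ?B r \<and> y \<in> ?B r"
      by (intro ballI case_prodI2) (rule edge, simp)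
  qed (fact tree_graph_add_leaf[OF tree t(1) l] cover)+
qed


section \<open>Graphs as colourings of pairs\<close>

text \<open>
  An odd number \<open>d < 2 * n\<close> stands for an arc of type \<open>d + 1\<close> traversed backwards, so that every
  ordered pair of adjacent vertices has exactly one label in \<open>{1..2 * n + m}\<close>; \<open>0\<close> means nonadjacent.
\<close>

definition opp :: "nat \<Rightarrow> nat \<Rightarrow> nat" where
  "opp n d = (if d = 0 \<or> d > 2 * n then d else if odd d then d + 1 else d - 1)"

lemma opp_0 [simp]: "opp n 0 = 0"
  by (simp add: opp_def)

lemma opp_opp [simp]: "opp n (opp n d) = d"
  unfolding opp_def by auto presburger+

lemma opp_eq_0_iff [simp]: "opp n d = 0 \<longleftrightarrow> d = 0"
  by (metis opp_0 opp_opp)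

lemma opp_pos_iff [simp]: "0 < opp n d \<longleftrightarrow> 0 < d"
  using opp_eq_0_iff by (metis neq0_conv)

lemma opp_le: "d \<le> 2 * n + m \<Longrightarrow> opp n d \<le> 2 * n + m"
  unfolding opp_def by auto presburger

definition colouring :: "nat \<Rightarrow> nat \<Rightarrow> 'a set \<Rightarrow> ('a \<Rightarrow> 'a \<Rightarrow> nat) \<Rightarrow> bool" where
  "colouring n m V c \<longleftrightarrow>
     finite V \<and> (\<forall>x\<in>V. c x x = 0) \<and>
     (\<forall>x\<in>V. \<forall>y\<in>V. c x y \<le> 2 * n + m \<and> c y x = opp n (c x y))"

text \<open>An odd arc label only repeats, seen from the head, an arc recorded under its even type,
  so just the labels that are types become adjacencies.\<close>

definition graph_of :: "nat \<Rightarrow> nat \<Rightarrow> 'a set \<Rightarrow> ('a \<Rightarrow> 'a \<Rightarrow> nat) \<Rightarrow> 'a nm_graph" where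
  "graph_of n m V c =
     \<lparr> nm_verts = V,
       nm_adj = (\<lambda>\<alpha>. if \<alpha> \<in> arc_types n \<union> edge_types n m then {(x, y) \<in> V \<times> V. c x y = \<alpha>} else {}) \<rparr>"

section \<open>Translation between graphs and labellings\<close>

lemma colouringD:
  assumes "colouring n m V c"
  shows "finite V" "x \<in> V \<Longrightarrow> c x x = 0" "x \<in> V \<Longrightarrow> y \<in> V \<Longrightarrow> c x y \<le> 2 * n + m"
    "x \<in> V \<Longrightarrow> y \<in> V \<Longrightarrow> c y x = opp n (c x y)"
  using assms unfolding colouring_def by blast+

lemma arc_types_iff: "\<alpha> \<in> arc_types n \<longleftrightarrow> even \<alpha> \<and> 2 \<le> \<alpha> \<and> \<alpha> \<le> 2 * n"
  unfolding arc_types_def by (auto elim!: evenE)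

lemma edge_types_iff: "\<alpha> \<in> edge_types n m \<longleftrightarrow> 2 * n < \<alpha> \<and> \<alpha> \<le> 2 * n + m"
  by (auto simp: edge_types_def)

lemma opp_arc_type: "\<alpha> \<in> arc_types n \<Longrightarrow> opp n \<alpha> = \<alpha> - 1 \<and> \<alpha> - 1 \<notin> arc_types n \<union> edge_types n m"
  by (auto simp: arc_types_iff edge_types_iff opp_def)

lemma opp_edge_type: "\<alpha> \<in> edge_types n m \<Longrightarrow> opp n \<alpha> = \<alpha>"
  by (auto simp: edge_types_iff opp_def)

lemma type_or_opp_type:
  assumes "d \<noteq> 0" "d \<le> 2 * n + m"
  shows "d \<in> arc_types n \<union> edge_types n m \<or> opp n d \<in> arc_types n \<union> edge_types n m"
  using assms unfolding opp_def by (auto simp: arc_types_iff edge_types_iff) presburger+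

lemma is_nm_graph_graph_of:
  assumes c: "colouring n m V c"
  shows "is_nm_graph n m (graph_of n m V c)"
proof -
  note D = colouringD[OF c]
  have "irrefl (nm_adj (graph_of n m V c) \<alpha>)" for \<alpha>
    using D(2) by (auto simp: graph_of_def irrefl_def arc_types_iff edge_types_iff)
  moreover have "sym (nm_adj (graph_of n m V c) \<alpha>)" if "\<alpha> \<in> edge_types n m" for \<alpha>
  proof (rule symI)
    fix x y
    assume "(x, y) \<in> nm_adj (graph_of n m V c) \<alpha>"
    then show "(y, x) \<in> nm_adj (graph_of n m V c) \<alpha>"
      using D(4)[of x y] opp_edge_type[OF that] that by (auto simp: graph_of_def)
  qed
  moreover have "asym (nm_adj (graph_of n m V c) \<alpha>)" if "\<alpha> \<in> arc_types n" for \<alpha>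
  proof (rule asymI)
    fix x y
    assume "(x, y) \<in> nm_adj (graph_of n m V c) \<alpha>"
    then show "(y, x) \<notin> nm_adj (graph_of n m V c) \<alpha>"
      using D(4)[of x y] opp_arc_type[OF that, of m] that by (auto simp: graph_of_def)
  qed
  moreover have "nm_adj (graph_of n m V c) \<alpha> \<inter> (nm_adj (graph_of n m V c) \<beta> \<union> (nm_adj (graph_of n m V c) \<beta>)\<inverse>) = {}"
    if "\<alpha> \<noteq> \<beta>" for \<alpha> \<beta>
  proof -
    have False if "\<alpha> \<in> arc_types n \<union> edge_types n m" "\<beta> \<in> arc_types n \<union> edge_types n m" "\<beta> = opp n \<alpha>"
      using that \<open>\<alpha> \<noteq> \<beta>\<close> opp_arc_type[of \<alpha> n m] opp_edge_type[of \<alpha> n m] by auto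
    then have "\<not> (x \<in> V \<and> y \<in> V \<and> c x y = \<alpha> \<and> (c x y = \<beta> \<or> c y x = \<beta>))"
      if "\<alpha> \<in> arc_types n \<union> edge_types n m" "\<beta> \<in> arc_types n \<union> edge_types n m" for x y
      using that \<open>\<alpha> \<noteq> \<beta>\<close> D(4) by metis
    then show ?thesis
      unfolding graph_of_def by (auto split: if_splits)
  qed
  ultimately show ?thesis
    unfolding is_nm_graph_def using D(1) by (auto simp: graph_of_def)
qed

lemma graph_of_exhaust:
  assumes G: "is_nm_graph n m G"
  obtains c where "colouring n m (nm_verts G) c" "G = graph_of n m (nm_verts G) c"
proof -
  let ?V = "nm_verts G" and ?A = "nm_adj G"
  let ?type = "\<lambda>x y. THE \<alpha>. (x, y) \<in> ?A \<alpha>"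
  \<comment> \<open>The label is read off forwards if possible, then backwards through
    \<open>opp\<close>, with default 0. The descriptions are meaningful because a pair carries at
    most one type, see \<open>uniq\<close>.\<close>
  define c where "c x y =
    (if \<exists>\<alpha>. (x, y) \<in> ?A \<alpha> then ?type x y else if \<exists>\<alpha>. (y, x) \<in> ?A \<alpha> then opp n (?type y x) else 0)" for x y
  note G' = G[unfolded is_nm_graph_def]
  have fin: "finite ?V"
    using G' by blast
  have sub: "?A \<alpha> \<subseteq> ?V \<times> ?V" for \<alpha>
    using G' by blast
  have type: "\<alpha> \<in> arc_types n \<union> edge_types n m" if "(x, y) \<in> ?A \<alpha>" for x y \<alpha>
    using G' that by blast
  have irr: "(x, x) \<notin> ?A \<alpha>" for x \<alpha>
    using G' by (simp add: irrefl_def)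
  have symE: "(y, x) \<in> ?A \<alpha>" if "\<alpha> \<in> edge_types n m" "(x, y) \<in> ?A \<alpha>" for x y \<alpha>
    using G' that by (meson symD)
  have asymA: "(y, x) \<notin> ?A \<alpha>" if "\<alpha> \<in> arc_types n" "(x, y) \<in> ?A \<alpha>" for x y \<alpha>
    using G' that by (meson asymD)
  have uniq: "\<alpha> = \<beta>" if "(x, y) \<in> ?A \<alpha>" "(x, y) \<in> ?A \<beta> \<or> (y, x) \<in> ?A \<beta>" for x y \<alpha> \<beta>
  proof (rule ccontr)
    assume "\<alpha> \<noteq> \<beta>"
    then have "?A \<alpha> \<inter> (?A \<beta> \<union> (?A \<beta>)\<inverse>) = {}"
      using G' by meson
    then show False
      using that by blast
  qed
  have fwd: "c x y = \<alpha>" if "(x, y) \<in> ?A \<alpha>" for x y \<alpha>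
  proof -
    have "?type x y = \<alpha>"
      using that uniq by blast
    then show ?thesis
      using that by (auto simp: c_def)
  qed
  have bwd: "c y x = opp n \<alpha>" if xy: "(x, y) \<in> ?A \<alpha>" for x y \<alpha>
  proof (cases "\<alpha> \<in> edge_types n m")
    case True
    then show ?thesis
      using fwd[OF symE[OF True xy]] opp_edge_type by simp
  next
    case False
    then have "(y, x) \<notin> ?A \<beta>" for \<beta>
      using type[OF xy] asymA[OF _ xy] uniq[OF xy, of \<beta>] by auto
    moreover have "?type x y = \<alpha>"
      using xy uniq by blast
    ultimately show ?thesis
      using xy by (auto simp: c_def)
  qed
  have none: "c x y = 0" if "\<And>\<alpha>. (x, y) \<notin> ?A \<alpha> \<and> (y, x) \<notin> ?A \<alpha>" for x y
    using that by (simp add: c_def)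
  have col: "colouring n m ?V c"
    unfolding colouring_def
  proof (intro conjI ballI)
    fix x y
    consider \<alpha> where "(x, y) \<in> ?A \<alpha>" | \<alpha> where "(y, x) \<in> ?A \<alpha>"
      | "\<And>\<alpha>. (x, y) \<notin> ?A \<alpha> \<and> (y, x) \<notin> ?A \<alpha>"
      by blast
    then have "c x y \<le> 2 * n + m \<and> c y x = opp n (c x y)"
    proof cases
      case 1
      have "\<alpha> \<le> 2 * n + m"
        using type[OF 1] by (auto simp: arc_types_iff edge_types_iff)
      then show ?thesis
        using fwd[OF 1] bwd[OF 1] by simp
    next
      case 2
      have "\<alpha> \<le> 2 * n + m"
        using type[OF 2] by (auto simp: arc_types_iff edge_types_iff)
      then show ?thesis
        using fwd[OF 2] bwd[OF 2] opp_le by simp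
    next
      case 3
      then show ?thesis
        using none[of x y] none[of y x] by simp
    qed
    then show "c x y \<le> 2 * n + m" "c y x = opp n (c x y)"
      by auto
    show "c x x = 0"
      using irr none by blast
  qed (fact fin)
  moreover have "nm_adj G \<alpha> = nm_adj (graph_of n m ?V c) \<alpha>" for \<alpha>
  proof (intro equalityI subrelI)
    fix x y
    assume "(x, y) \<in> ?A \<alpha>"
    then show "(x, y) \<in> nm_adj (graph_of n m ?V c) \<alpha>"
      using fwd type sub by (fastforce simp: graph_of_def)
  next
    fix x y
    assume "(x, y) \<in> nm_adj (graph_of n m ?V c) \<alpha>"
    then have xy: "c x y = \<alpha>" "\<alpha> \<in> arc_types n \<union> edge_types n m"
      by (auto simp: graph_of_def split: if_splits)
    consider \<beta> where "(x, y) \<in> ?A \<beta>" | \<beta> where "(y, x) \<in> ?A \<beta>" "(x, y) \<notin> ?A \<beta>"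
      | "\<And>\<beta>. (x, y) \<notin> ?A \<beta> \<and> (y, x) \<notin> ?A \<beta>"
      by blast
    then show "(x, y) \<in> ?A \<alpha>"
    proof cases
      case 1
      then show ?thesis
        using fwd xy by blast
    next
      case 2
      \<comment> \<open>An edge type would be symmetric. So \<open>c x y\<close> is the odd label
        \<open>opp n \<beta>\<close>, which is no type, against the choice of
        \<open>\<alpha>\<close>.\<close>
      then have "\<beta> \<in> arc_types n"
        using type symE by blast
      then show ?thesis
        using bwd[OF 2(1)] xy opp_arc_type[of \<beta> n m] by metis
    next
      case 3
      then show ?thesis
        using none[of x y] xy by (auto simp: arc_types_iff edge_types_iff)
    qed
  qed
  then have "G = graph_of n m ?V c"
    by (cases G) (auto simp: graph_of_def)
  ultimately show ?thesis
    using that by blast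
qed

lemma nm_verts_graph_of [simp]: "nm_verts (graph_of n m V c) = V"
  by (simp add: graph_of_def)

lemma und_graph_of:
  assumes c: "colouring n m V c"
  shows "und (graph_of n m V c) = \<lparr> pverts = V, parcs = {(x, y) \<in> V \<times> V. c x y \<noteq> 0} \<rparr>"
proof -
  have "(x, y) \<in> parcs (und (graph_of n m V c)) \<longleftrightarrow> x \<in> V \<and> y \<in> V \<and> c x y \<noteq> 0" for x y
  proof
    assume "(x, y) \<in> parcs (und (graph_of n m V c))"
    then obtain \<alpha> where "\<alpha> \<in> arc_types n \<union> edge_types n m" "x \<in> V" "y \<in> V" "c x y = \<alpha> \<or> c y x = \<alpha>"
      by (auto simp: und_def graph_of_def split: if_splits)
    moreover from this have "\<alpha> \<noteq> 0"
      by (auto simp: arc_types_iff edge_types_iff)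
    ultimately show "x \<in> V \<and> y \<in> V \<and> c x y \<noteq> 0"
      using colouringD(4)[OF c, of x y] by (metis opp_0)
  next
    assume xy: "x \<in> V \<and> y \<in> V \<and> c x y \<noteq> 0"
    then have "c x y \<in> arc_types n \<union> edge_types n m \<or> c y x \<in> arc_types n \<union> edge_types n m"
      using type_or_opp_type[of "c x y" n m] colouringD(3,4)[OF c, of x y] by auto
    then show "(x, y) \<in> parcs (und (graph_of n m V c))"
      using xy by (fastforce simp: und_def graph_of_def)
  qed
  moreover have "pverts (und (graph_of n m V c)) = V"
    by (simp add: und_def)
  ultimately show ?thesis
    by (intro pair_pre_digraph.equality) auto
qed

text \<open>A nonzero label that is not a type becomes one when the pair is reversed; applying
  \<open>opp\<close> on both sides transfers preservation back.\<close>

lemma nm_hom_graph_of_iff: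
  assumes c: "colouring n m V c" and d: "colouring n m W d"
  shows "nm_hom (graph_of n m V c) (graph_of n m W d) f \<longleftrightarrow>
    f ` V \<subseteq> W \<and> (\<forall>x\<in>V. \<forall>y\<in>V. c x y \<noteq> 0 \<longrightarrow> d (f x) (f y) = c x y)" (is "?L \<longleftrightarrow> ?R")
proof
  assume L: ?L
  then have fV: "f ` V \<subseteq> W"
    by (simp add: nm_hom_def)
  have pres: "d (f x) (f y) = c x y"
    if "x \<in> V" "y \<in> V" "c x y \<in> arc_types n \<union> edge_types n m" for x y
  proof -
    have "(x, y) \<in> nm_adj (graph_of n m V c) (c x y)"
      using that by (simp add: graph_of_def)
    then have "(f x, f y) \<in> nm_adj (graph_of n m W d) (c x y)"
      using L by (auto simp: nm_hom_def)
    then show ?thesis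
      by (simp add: graph_of_def split: if_splits)
  qed
  have "d (f x) (f y) = c x y" if xy: "x \<in> V" "y \<in> V" "c x y \<noteq> 0" for x y
  proof (cases "c x y \<in> arc_types n \<union> edge_types n m")
    case False
    then have "c y x \<in> arc_types n \<union> edge_types n m"
      using type_or_opp_type[of "c x y" n m] colouringD(3,4)[OF c, of x y] xy by auto
    then have "d (f y) (f x) = c y x"
      using pres xy by blast
    then show ?thesis
      using xy fV colouringD(4)[OF c, of x y] colouringD(4)[OF d, of "f x" "f y"] by (metis image_subset_iff opp_opp)
  qed (use pres xy in blast)
  then show ?R
    using fV by blast
next
  assume ?R
  then show ?L
    by (auto simp: nm_hom_def graph_of_def arc_types_iff edge_types_iff split: if_splits)
qed


section \<open>Homomorphisms from partial 2-trees\<close>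

text \<open>Suppose \<open>x\<close> lies in \<open>B t\<close> and in \<open>B r\<close> with
  \<open>r\<close> in \<open>X\<close>, but not in \<open>B s\<close>. The nodes holding
  \<open>x\<close> lead from \<open>t\<close> to \<open>r\<close> without \<open>s\<close>, and
  \<open>X\<close> leads from \<open>r\<close> to \<open>s\<close> without \<open>t\<close>: a
  detour around a tree edge.\<close>

lemma bag_boundary:
  assumes td: "tree_decomposition S T B" and X: "connected_in (parcs T) X" "X \<subseteq> pverts T"
    and st: "(s, t) \<in> parcs T" "s \<in> X" "t \<in> pverts T - X"
  shows "B t \<inter> (\<Union>r\<in>X. B r) \<subseteq> B s"
proof (rule ccontr)
  assume "\<not> ?thesis"
  then obtain x r where x: "x \<in> B t" "x \<in> B r" "r \<in> X" "x \<notin> B s"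
    by blast
  let ?E = "parcs T - {(s, t), (t, s)}" and ?D = "{q \<in> pverts T. x \<in> B q}"
  have tree: "pair_graph T" "acyclic_graph T"
    using td by (auto simp: tree_decomposition_iff tree_graph_iff)
  have "x \<in> pverts S"
    using td x st by (auto simp: tree_decomposition_iff)
  then have "connected_in (parcs T) ?D"
    using td by (auto simp: tree_decomposition_iff)
  then have "(t, r) \<in> (Restr (parcs T) ?D)\<^sup>*"
    using x st X by (intro connected_inD) auto
  moreover have "(Restr (parcs T) ?D)\<^sup>* \<subseteq> ?E\<^sup>*"
    using x by (intro rtrancl_mono) auto
  moreover have "(r, s) \<in> (Restr (parcs T) X)\<^sup>*"
    using x st X by (intro connected_inD) auto
  moreover have "(Restr (parcs T) X)\<^sup>* \<subseteq> ?E\<^sup>*"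
    using st by (intro rtrancl_mono) auto
  ultimately have "(t, s) \<in> ?E\<^sup>*"
    by (meson rtrancl_trans subsetD)
  then show False
    using acyclic_graph_no_detour[OF tree st(1)] by blast
qed

section \<open>Extending maps bag by bag\<close>

definition triangle_complete :: "nat \<Rightarrow> 'a set \<Rightarrow> ('a \<Rightarrow> 'a \<Rightarrow> nat) \<Rightarrow> bool" where
  "triangle_complete k W d \<longleftrightarrow>
     (\<forall>x\<in>W. \<forall>y\<in>W. d x y \<noteq> 0 \<longrightarrow> (\<forall>a\<in>{1..k}. \<forall>b\<in>{1..k}. \<exists>w\<in>W. d x w = a \<and> d y w = b))"

lemma triangle_completeD:
  assumes "triangle_complete k W d" "x \<in> W" "y \<in> W" "d x y \<noteq> 0" "a \<in> {1..k}" "b \<in> {1..k}"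
  obtains w where "w \<in> W" "d x w = a" "d y w = b"
  using assms unfolding triangle_complete_def by blast

text \<open>Here \<open>p\<close> labels every pair of distinct vertices, so that \<open>f\<close>
  acts as a homomorphism from the clique on \<open>A\<close>.\<close>

definition realises :: "('a \<Rightarrow> 'a \<Rightarrow> nat) \<Rightarrow> 'b set \<Rightarrow> ('b \<Rightarrow> 'b \<Rightarrow> nat) \<Rightarrow> ('a \<Rightarrow> 'b) \<Rightarrow> 'a set \<Rightarrow> bool" where
  "realises p W d f A \<longleftrightarrow> f ` A \<subseteq> W \<and> (\<forall>x\<in>A. \<forall>y\<in>A. x \<noteq> y \<longrightarrow> d (f x) (f y) = p x y)"

lemma realises_subset: "realises p W d f A \<Longrightarrow> A' \<subseteq> A \<Longrightarrow> realises p W d f A'"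
  by (auto simp: realises_def)

lemma realises_cong: "(\<And>x. x \<in> A \<Longrightarrow> f x = g x) \<Longrightarrow> realises p W d f A \<longleftrightarrow> realises p W d g A"
  by (simp add: realises_def cong: image_cong_simp)

text \<open>The last two assumptions start an extension with no vertex or one vertex mapped;
  \<open>complete\<close> handles two.\<close>

locale extension_target =
  fixes n m :: nat and W :: "'b set" and d :: "'b \<Rightarrow> 'b \<Rightarrow> nat"
  assumes colouring_target: "colouring n m W d"
    and complete: "triangle_complete (2 * n + m) W d"
    and nonempty: "W \<noteq> {}"
    and no_isolated: "\<And>x. x \<in> W \<Longrightarrow> \<exists>y\<in>W. d x y \<noteq> 0"
begin

lemma neighbour:
  assumes "x \<in> W" "a \<in> {1..2 * n + m}"
  obtains w where "w \<in> W" "d x w = a"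
proof -
  obtain y where "y \<in> W" "d x y \<noteq> 0"
    using no_isolated assms by blast
  then show ?thesis
    using triangle_completeD[OF complete assms(1) _ _ assms(2) assms(2)] that by metis
qed

lemma common_neighbour:
  assumes p: "\<And>x y. x \<noteq> y \<Longrightarrow> p x y \<in> {1..2 * n + m}"
    and f: "realises p W d f A" and A: "finite A" "card A \<le> 2" and z: "z \<notin> A"
  obtains w where "w \<in> W" "\<And>x. x \<in> A \<Longrightarrow> d (f x) w = p x z"
proof -
  consider "A = {}" | x where "A = {x}" | x y where "A = {x, y}" "x \<noteq> y"
    using A by (metis card_0_eq card_1_singletonE card_2_iff le_Suc_eq le_zero_eq numeral_2_eq_2 One_nat_def)
  then show ?thesis
  proof cases
    case 1
    then show ?thesis
      using nonempty that by blast
  next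
    case 2
    then have "f x \<in> W" "p x z \<in> {1..2 * n + m}"
      using f p z by (auto simp: realises_def)
    then show ?thesis
      using neighbour 2 that by (metis singletonD)
  next
    case 3
    then have im: "f x \<in> W" "f y \<in> W" and dxy: "d (f x) (f y) = p x y" and "x \<noteq> z" "y \<noteq> z"
      using f z by (auto simp: realises_def)
    have "d (f x) (f y) \<noteq> 0"
      using dxy p[OF 3(2)] by auto
    then obtain w where "w \<in> W" "d (f x) w = p x z" "d (f y) w = p y z"
      using triangle_completeD[OF complete im _ p[OF \<open>x \<noteq> z\<close>] p[OF \<open>y \<noteq> z\<close>]] by blast
    then show ?thesis
      using 3 that[of w] by blast
  qed
qed

text \<open>The vertices of \<open>B - A\<close> are mapped one at a time. As \<open>B\<close> has
  at most three vertices, at most two are mapped before each addition, so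
  \<open>common_neighbour\<close> applies.\<close>

lemma extend_to_bag:
  assumes p: "\<And>x y. x \<noteq> y \<Longrightarrow> p x y \<in> {1..2 * n + m}" "\<And>x y. x \<noteq> y \<Longrightarrow> p y x = opp n (p x y)"
    and f: "realises p W d f A" and B: "A \<subseteq> B" "finite B" "card B \<le> 3"
  obtains g where "\<And>x. x \<in> A \<Longrightarrow> g x = f x" "realises p W d g B"
proof -
  have "\<exists>g. (\<forall>x\<in>A. g x = f x) \<and> realises p W d g (A \<union> C)"
    if "finite C" "A \<inter> C = {}" "A \<union> C \<subseteq> B" for C
    using that
  proof (induct C)
    case empty
    then show ?case
      using f by auto
  next
    case (insert z C)
    then obtain g where g: "\<forall>x\<in>A. g x = f x" "realises p W d g (A \<union> C)"
      by auto
    have z: "z \<notin> A \<union> C"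
      using insert by auto
    have fin: "finite (A \<union> C)"
      using insert B finite_subset by (metis Un_subset_iff finite_Un finite_insert)
    have "card (insert z (A \<union> C)) \<le> 3"
      using insert B card_mono[of B "insert z (A \<union> C)"] by auto
    then have "card (A \<union> C) \<le> 2"
      using z fin by simp
    then obtain w where w: "w \<in> W" "\<And>x. x \<in> A \<union> C \<Longrightarrow> d (g x) w = p x z"
      using common_neighbour[OF p(1) g(2) fin _ z] by metis
    have "d w (g x) = p z x" if "x \<in> A \<union> C" for x
    proof -
      have "g x \<in> W" "x \<noteq> z"
        using g(2) that z by (auto simp: realises_def)
      then show ?thesis
        using colouringD(4)[OF colouring_target, of "g x" w] w p(2) that by metis
    qed
    then have "realises p W d (g(z := w)) (insert z (A \<union> C))"
      using g(2) w z by (auto simp: realises_def)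
    moreover have "\<forall>x\<in>A. (g(z := w)) x = f x"
      using g(1) z by auto
    ultimately show ?case
      by (metis Un_insert_right)
  qed
  from this[of "B - A"] obtain g where "\<forall>x\<in>A. g x = f x" "realises p W d g (A \<union> (B - A))"
    using B by auto
  then show ?thesis
    using that B by (metis Un_Diff_cancel sup.absorb2)
qed

text \<open>Take a maximal connected set \<open>X\<close> of nodes whose bags are realised by one
  map. If a node is missing, one adjacent to \<open>X\<close> can be added, because its bag meets
  the earlier bags inside a single realised bag.\<close>

lemma realises_tree_decomposition:
  assumes p: "\<And>x y. x \<noteq> y \<Longrightarrow> p x y \<in> {1..2 * n + m}" "\<And>x y. x \<noteq> y \<Longrightarrow> p y x = opp n (p x y)"
    and S: "pair_graph S" and td: "tree_decomposition S T B"
    and width: "\<And>t. t \<in> pverts T \<Longrightarrow> card (B t) \<le> 3"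
  obtains f where "\<And>t. t \<in> pverts T \<Longrightarrow> realises p W d f (B t)"
proof -
  let ?good = "\<lambda>X. X \<subseteq> pverts T \<and> connected_in (parcs T) X \<and> (\<exists>f. \<forall>t\<in>X. realises p W d f (B t))"
  have con: "connected_in (parcs T) (pverts T)" and finT: "finite (pverts T)" and sym: "sym (parcs T)"
    using td by (auto simp: tree_decomposition_iff tree_graph_iff pair_graph_iff)
  have finB: "finite (B t)" if "t \<in> pverts T" for t
    using td S that by (auto simp: tree_decomposition_iff pair_graph_iff intro: finite_subset)
  obtain t0 where t0: "t0 \<in> pverts T"
    using con by (auto simp: connected_in_def)
  have "realises p W d undefined {}"
    by (simp add: realises_def)
  from extend_to_bag[OF p this empty_subsetI finB[OF t0] width[OF t0]]
  obtain f0 where "realises p W d f0 (B t0)" .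
  then have "{t0} \<in> Collect ?good"
    using t0 connected_in_singleton by auto
  moreover have "finite (Collect ?good)"
    using finT by auto
  ultimately obtain X where X: "?good X" "\<And>Y. ?good Y \<Longrightarrow> X \<subseteq> Y \<Longrightarrow> X = Y"
    using finite_has_maximal2[of "Collect ?good" "{t0}"] by auto
  then obtain f where f: "\<And>t. t \<in> X \<Longrightarrow> realises p W d f (B t)"
    by blast
  have "X = pverts T"
  proof (rule ccontr)
    assume "X \<noteq> pverts T"
    then obtain s t where st: "s \<in> X" "t \<in> pverts T - X" "(s, t) \<in> parcs T"
      using connected_in_exit[OF con, of X] X(1) by (auto simp: connected_in_def)
    let ?A = "B t \<inter> (\<Union>r\<in>X. B r)"
    have "?A \<subseteq> B s"
      using bag_boundary[OF td _ _ st(3,1,2)] X(1) by blast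
    with f[OF st(1)] have "realises p W d f ?A"
      by (rule realises_subset)
    from extend_to_bag[OF p this inf_le1 finB width]
    obtain g where g: "\<And>x. x \<in> ?A \<Longrightarrow> g x = f x" "realises p W d g (B t)"
      using st(2) by (metis DiffD1)
    let ?h = "\<lambda>x. if x \<in> B t then g x else f x"
    have "realises p W d ?h (B t)"
      using g(2) realises_cong[of "B t" ?h g] by simp
    moreover have "realises p W d ?h (B r)" if "r \<in> X" for r
    proof -
      \<comment> \<open>A vertex of \<open>B r\<close> that also lies in \<open>B t\<close> belongs
        to \<open>?A\<close>, where \<open>g\<close> agrees with \<open>f\<close>.\<close>
      have "?h x = f x" if "x \<in> B r" for x
        using g(1) that \<open>r \<in> X\<close> by auto
      then show ?thesis
        using f[OF that] realises_cong[of "B r" ?h f] by simp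
    qed
    ultimately have "\<exists>f. \<forall>r\<in>insert t X. realises p W d f (B r)"
      by (intro exI[of _ ?h]) simp
    moreover have "connected_in (parcs T) (insert t X)"
      using X(1) st symD[OF sym st(3)] by (intro connected_in_insert) simp_all
    ultimately have "?good (insert t X)"
      using X(1) st by simp
    then show False
      using X(2)[of "insert t X"] st by blast
  qed
  then show ?thesis
    using that f by blast
qed

lemma hom_to_target:
  fixes V :: "nat set"
  assumes k: "2 * n + m \<ge> 1" and c: "colouring n m V c"
    and td: "tree_decomposition (und (graph_of n m V c)) T B"
    and width: "\<And>t. t \<in> pverts T \<Longrightarrow> card (B t) \<le> 3"
  shows "\<exists>f. nm_hom (graph_of n m V c) (graph_of n m W d) f"
proof -
  \<comment> \<open>All pairs get a label, as if the bags were cliques.\<close>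
  define p where "p x y =
    (if x \<in> V \<and> y \<in> V \<and> c x y \<noteq> 0 then c x y else if x < y then 1 else opp n 1)" for x y
  have p1: "p x y \<in> {1..2 * n + m}" if "x \<noteq> y" for x y
    using k colouringD(3)[OF c, of x y] opp_le[of 1 n m]
    unfolding p_def by (auto simp: Suc_le_eq)
  \<comment> \<open>For added pairs the order of the vertices decides which direction gets 1, so the
    two labels are opposite even when 1 denotes a reversed arc.\<close>
  have p2: "p y x = opp n (p x y)" if "x \<noteq> y" for x y
    using that colouringD(4)[OF c, of x y] by (auto simp: p_def)
  obtain f where f: "\<And>t. t \<in> pverts T \<Longrightarrow> realises p W d f (B t)"
    using realises_tree_decomposition[where p = p, OF p1 p2 pair_graph_und[OF is_nm_graph_graph_of[OF c]] td width]
    by blast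
  have bags: "(\<Union>t\<in>pverts T. B t) = V"
    and edges: "\<And>x y. x \<in> V \<Longrightarrow> y \<in> V \<Longrightarrow> c x y \<noteq> 0 \<Longrightarrow> \<exists>t\<in>pverts T. x \<in> B t \<and> y \<in> B t"
    using td unfolding tree_decomposition_iff und_graph_of[OF c] by auto
  have "f ` V \<subseteq> W"
    using f bags by (auto simp: realises_def)
  moreover have "d (f x) (f y) = c x y" if xy: "x \<in> V" "y \<in> V" "c x y \<noteq> 0" for x y
  proof -
    obtain t where "t \<in> pverts T" "x \<in> B t" "y \<in> B t"
      using edges xy by blast
    moreover have "x \<noteq> y"
      using xy colouringD(2)[OF c xy(1)] by auto
    ultimately have "d (f x) (f y) = p x y"
      using f by (auto simp: realises_def)
    then show ?thesis
      using xy by (simp add: p_def)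
  qed
  ultimately show ?thesis
    unfolding nm_hom_graph_of_iff[OF c colouring_target] by blast
qed

end


section \<open>Universal coloured 2-trees\<close>

lemma opp_in_range: "a \<in> {1..2 * n + m} \<Longrightarrow> opp n a \<in> {1..2 * n + m}"
  using opp_le[of a n m] by (auto simp: Suc_le_eq)

text \<open>Bounding bag sizes directly avoids \<open>LEAST\<close> and \<open>Max\<close>;
  \<open>treewidth_le_2_iff\<close> makes the link to treewidth.\<close>

definition partial_2_tree :: "'a pair_pre_digraph \<Rightarrow> bool" where
  "partial_2_tree S \<longleftrightarrow>
     (\<exists>(T :: nat pair_pre_digraph) B. tree_decomposition S T B \<and> (\<forall>t\<in>pverts T. card (B t) \<le> 3))"

definition coloured_2_tree :: "nat \<Rightarrow> nat \<Rightarrow> 'a set \<Rightarrow> ('a \<Rightarrow> 'a \<Rightarrow> nat) \<Rightarrow> bool" where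
  "coloured_2_tree n m V c \<longleftrightarrow> colouring n m V c \<and> partial_2_tree (und (graph_of n m V c))"

definition extends :: "'a set \<times> ('a \<Rightarrow> 'a \<Rightarrow> nat) \<Rightarrow> 'a set \<times> ('a \<Rightarrow> 'a \<Rightarrow> nat) \<Rightarrow> bool" where
  "extends G G' \<longleftrightarrow> fst G \<subseteq> fst G' \<and> (\<forall>x\<in>fst G. \<forall>y\<in>fst G. snd G' x y = snd G x y)"

lemma extends_refl: "extends G G"
  by (simp add: extends_def)

lemma extends_trans: "extends G G' \<Longrightarrow> extends G' G'' \<Longrightarrow> extends G G''"
  unfolding extends_def by (metis subsetD subset_trans)

lemma coloured_2_tree_edge:
  assumes "2 * n + m \<ge> 1"
  obtains c where "coloured_2_tree n m {0, 1 :: nat} c" "c 0 1 = 1"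
proof -
  define c where "c x y = (if x = 0 \<and> y = 1 then 1 else if x = 1 \<and> y = 0 then opp n 1 else 0)" for x y :: nat
  have col: "colouring n m {0, 1} c"
    using assms opp_le[of 1 n m] by (auto simp: colouring_def c_def)
  have "pverts (und (graph_of n m {0, 1} c)) = {0, 1}"
    by (simp add: und_def)
  then have "tree_decomposition (und (graph_of n m {0, 1} c)) \<lparr> pverts = {0}, parcs = {} \<rparr> (\<lambda>_. {0, 1})"
    using tree_decomposition_singleton[OF pair_graph_und[OF is_nm_graph_graph_of[OF col]], of 0] by simp
  then have "partial_2_tree (und (graph_of n m {0, 1} c))"
    unfolding partial_2_tree_def by (intro exI conjI) auto
  then show ?thesis
    using that col by (simp add: coloured_2_tree_def c_def)
qed

text \<open>A fresh vertex is attached to \<open>u\<close> and \<open>v\<close> only. It costs one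
  new leaf with a bag of three vertices.\<close>

lemma coloured_2_tree_add_triangle:
  fixes V :: "nat set"
  assumes G: "coloured_2_tree n m V c" and uv: "u \<in> V" "v \<in> V" "c u v \<noteq> 0"
    and ab: "a \<in> {1..2 * n + m}" "b \<in> {1..2 * n + m}"
  obtains V' c' w where "coloured_2_tree n m V' c'" "extends (V, c) (V', c')" "w \<in> V'"
    "c' u w = a" "c' v w = b"
proof -
  have col: "colouring n m V c"
    using G by (simp add: coloured_2_tree_def)
  then have finV: "finite V"
    by (rule colouringD)
  then obtain w where w: "w \<notin> V"
    using ex_new_if_finite infinite_UNIV_nat by blast
  obtain T :: "nat pair_pre_digraph" and B where
    td: "tree_decomposition (und (graph_of n m V c)) T B" and width: "\<forall>t\<in>pverts T. card (B t) \<le> 3"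
    using G by (auto simp: coloured_2_tree_def partial_2_tree_def)
  have "finite (pverts T)"
    using td by (auto simp: tree_decomposition_iff tree_graph_iff pair_graph_iff)
  then obtain l where l: "l \<notin> pverts T"
    using ex_new_if_finite infinite_UNIV_nat by blast
  have distinct: "u \<noteq> v" "u \<noteq> w" "v \<noteq> w"
    using uv w colouringD(2)[OF col] by auto
  define c' where "c' x y =
    (if x = w then if y = u then opp n a else if y = v then opp n b else 0
     else if y = w then if x = u then a else if x = v then b else 0 else c x y)" for x y
  have col': "colouring n m (insert w V) c'"
    unfolding colouring_def
  proof (intro conjI ballI)
    fix x y
    assume xy: "x \<in> insert w V" "y \<in> insert w V"
    show "c' x y \<le> 2 * n + m"
      using xy colouringD(3)[OF col] ab opp_in_range[OF ab(1)] opp_in_range[OF ab(2)] by (auto simp: c'_def)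
    show "c' y x = opp n (c' x y)"
      using xy colouringD(4)[OF col, of x y] distinct by (auto simp: c'_def)
  next
    fix x
    assume "x \<in> insert w V"
    then show "c' x x = 0"
      using colouringD(2)[OF col] distinct by (auto simp: c'_def)
  qed (simp add: finV)
  let ?S = "und (graph_of n m V c)"
  have ab0: "a \<noteq> 0" "b \<noteq> 0"
    using ab by auto
  have und': "und (graph_of n m (insert w V) c') =
    \<lparr> pverts = insert w (pverts ?S), parcs = {(u, w), (w, u), (v, w), (w, v)} \<union> parcs ?S \<rparr>"
    using uv w distinct ab0
    by (auto simp: und_graph_of[OF col] und_graph_of[OF col'] c'_def split: if_splits)
  obtain t where td': "tree_decomposition (und (graph_of n m (insert w V) c'))
    \<lparr> pverts = insert l (pverts T), parcs = {(t, l), (l, t)} \<union> parcs T \<rparr> (B(l := {u, v, w}))"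
    unfolding und'
    by (rule tree_decomposition_add_triangle[OF td pair_graph_und[OF is_nm_graph_graph_of[OF col]] _ _ l, of u v w])
      (use uv w in \<open>auto simp: und_graph_of[OF col]\<close>)
  have "partial_2_tree (und (graph_of n m (insert w V) c'))"
    unfolding partial_2_tree_def
    by (rule exI, rule exI, rule conjI, rule td') (use width in \<open>simp add: card_insert_if\<close>)
  then have "coloured_2_tree n m (insert w V) c'"
    using col' by (simp add: coloured_2_tree_def)
  moreover have "extends (V, c) (insert w V, c')"
    using w by (auto simp: extends_def c'_def)
  moreover have "c' u w = a" "c' v w = b"
    using distinct by (auto simp: c'_def)
  ultimately show ?thesis
    using that by blast
qed

section \<open>Stacking triangles layer by layer\<close>

definition has_triangle :: "'a set \<times> ('a \<Rightarrow> 'a \<Rightarrow> nat) \<Rightarrow> 'a \<times> 'a \<times> nat \<times> nat \<Rightarrow> bool" where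
  "has_triangle G q \<longleftrightarrow>
     (case q of (u, v, a, b) \<Rightarrow> \<exists>w\<in>fst G. snd G u w = a \<and> snd G v w = b)"

definition requests :: "nat \<Rightarrow> 'a set \<times> ('a \<Rightarrow> 'a \<Rightarrow> nat) \<Rightarrow> ('a \<times> 'a \<times> nat \<times> nat) set" where
  "requests k G = {(u, v, a, b). u \<in> fst G \<and> v \<in> fst G \<and> snd G u v \<noteq> 0 \<and> a \<in> {1..k} \<and> b \<in> {1..k}}"

lemma finite_requests: "finite (fst G) \<Longrightarrow> finite (requests k G)"
  by (rule finite_subset[of _ "fst G \<times> fst G \<times> {1..k} \<times> {1..k}"]) (auto simp: requests_def)

lemma requests_mono: "extends G G' \<Longrightarrow> requests k G \<subseteq> requests k G'"
  by (auto simp: requests_def extends_def)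

lemma has_triangle_mono:
  "extends G G' \<Longrightarrow> q \<in> requests k G \<Longrightarrow> has_triangle G q \<Longrightarrow> has_triangle G' q"
  by (auto simp: requests_def extends_def has_triangle_def)

text \<open>The finitely many requests of \<open>G\<close> are met one after the other; triangles
  built earlier survive, since an extension keeps all labels between old vertices.\<close>

lemma coloured_2_tree_layer:
  fixes G :: "nat set \<times> (nat \<Rightarrow> nat \<Rightarrow> nat)"
  assumes G: "coloured_2_tree n m (fst G) (snd G)"
  shows "\<exists>G'. coloured_2_tree n m (fst G') (snd G') \<and> extends G G' \<and> (\<forall>q\<in>requests (2 * n + m) G. has_triangle G' q)"
proof -
  let ?k = "2 * n + m"
  have "\<exists>G'. coloured_2_tree n m (fst G') (snd G') \<and> extends G G' \<and> (\<forall>q\<in>Q. has_triangle G' q)"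
    if "finite Q" "Q \<subseteq> requests ?k G" for Q
    using that
  proof (induct Q)
    case empty
    then show ?case
      using G extends_refl by blast
  next
    case (insert q Q)
    then obtain G' where G': "coloured_2_tree n m (fst G') (snd G')" "extends G G'"
      "\<And>r. r \<in> Q \<Longrightarrow> has_triangle G' r"
      by auto
    obtain u v a b where q: "q = (u, v, a, b)"
      by (cases q)
    have "q \<in> requests ?k G'"
      using insert G'(2) requests_mono by blast
    then have "u \<in> fst G'" "v \<in> fst G'" "snd G' u v \<noteq> 0" "a \<in> {1..?k}" "b \<in> {1..?k}"
      by (simp_all add: requests_def q)
    from coloured_2_tree_add_triangle[OF G'(1) this]
    obtain V'' c'' w where G'': "coloured_2_tree n m V'' c''" "extends (fst G', snd G') (V'', c'')"
      and w: "w \<in> V''" "c'' u w = a" "c'' v w = b" .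
    have ext: "extends G' (V'', c'')"
      using G''(2) by simp
    have "has_triangle (V'', c'') q"
      using w by (auto simp: has_triangle_def q)
    moreover have "has_triangle (V'', c'') r" if "r \<in> Q" for r
      using has_triangle_mono[OF ext _ G'(3)[OF that]] requests_mono[OF G'(2)] insert that by blast
    ultimately show ?case
      using G''(1) extends_trans[OF G'(2) ext] by (intro exI[of _ "(V'', c'')"]) simp
  qed
  moreover have "finite (requests ?k G)"
    using G colouringD(1) by (intro finite_requests) (auto simp: coloured_2_tree_def)
  ultimately show ?thesis
    by blast
qed

lemma coloured_2_tree_sequence:
  assumes "2 * n + m \<ge> 1"
  obtains G :: "nat \<Rightarrow> nat set \<times> (nat \<Rightarrow> nat \<Rightarrow> nat)" where
    "\<And>i. coloured_2_tree n m (fst (G i)) (snd (G i))"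
    "\<And>i. extends (G i) (G (Suc i))"
    "\<And>i q. q \<in> requests (2 * n + m) (G i) \<Longrightarrow> has_triangle (G (Suc i)) q"
    "\<exists>u\<in>fst (G 0). \<exists>v\<in>fst (G 0). snd (G 0) u v \<noteq> 0"
proof -
  obtain c where c: "coloured_2_tree n m {0, 1 :: nat} c" "c 0 1 = 1"
    using coloured_2_tree_edge[OF assms] .
  \<comment> \<open>The clause for \<open>i = 0\<close> records the initial edge and is vacuous at
    later stages.\<close>
  let ?P = "\<lambda>i (G :: nat set \<times> (nat \<Rightarrow> nat \<Rightarrow> nat)).
    coloured_2_tree n m (fst G) (snd G) \<and> (i = 0 \<longrightarrow> (\<exists>u\<in>fst G. \<exists>v\<in>fst G. snd G u v \<noteq> 0))"
  let ?Q = "\<lambda>(i :: nat) (G :: nat set \<times> (nat \<Rightarrow> nat \<Rightarrow> nat)) G'.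
    extends G G' \<and> (\<forall>q\<in>requests (2 * n + m) G. has_triangle G' q)"
  have "\<exists>G. ?P 0 G"
    using c by (intro exI[of _ "({0, 1}, c)"]) auto
  moreover have "\<exists>G'. ?P (Suc i) G' \<and> ?Q i G G'" if "?P i G" for i G
    using that coloured_2_tree_layer[of n m G] by blast
  ultimately have "\<exists>G. \<forall>i. ?P i (G i) \<and> ?Q i (G i) (G (Suc i))"
    by (rule dependent_nat_choice)
  then show ?thesis
    using that by blast
qed


section \<open>Closed sets of edges in a target\<close>

text \<open>Each round deletes the edges lacking some triangle among the survivors. A set unchanged
  by a round is closed in the sense of \<open>closed_edges\<close>.\<close>

primrec pruned :: "nat \<Rightarrow> 'a set \<Rightarrow> ('a \<Rightarrow> 'a \<Rightarrow> nat) \<Rightarrow> nat \<Rightarrow> 'a rel" where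
  "pruned k W d 0 = {(x, y) \<in> W \<times> W. d x y \<noteq> 0}"
| "pruned k W d (Suc i) = {(x, y) \<in> pruned k W d i. \<forall>a\<in>{1..k}. \<forall>b\<in>{1..k}.
     \<exists>w. (x, w) \<in> pruned k W d i \<and> (y, w) \<in> pruned k W d i \<and> d x w = a \<and> d y w = b}"

lemma pruned_antimono: "i \<le> j \<Longrightarrow> pruned k W d j \<subseteq> pruned k W d i"
  by (induct rule: dec_induct) auto

text \<open>Each unstable round loses an edge, and there are at most \<open>card W * card W\<close>
  of them to lose.\<close>

lemma pruned_stable:
  assumes "finite W"
  shows "\<exists>i \<le> card W * card W. pruned k W d (Suc i) = pruned k W d i"
proof (rule ccontr)
  let ?P = "pruned k W d"
  assume "\<not> (\<exists>i \<le> card W * card W. ?P (Suc i) = ?P i)"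
  then have strict: "?P (Suc i) \<subset> ?P i" if "i \<le> card W * card W" for i
    using pruned_antimono[of i "Suc i" k W d] that by (simp only: psubset_eq le_SucI le_refl) blast
  have sub: "?P i \<subseteq> W \<times> W" for i
    using pruned_antimono[of 0 i k W d] by auto
  have fin: "finite (?P i)" for i
    using sub assms by (meson finite_SigmaI finite_subset)
  have "card (?P i) + i \<le> card W * card W" if "i \<le> Suc (card W * card W)" for i
    using that
  proof (induct i)
    case 0
    then show ?case
      using card_mono[OF _ sub[of 0]] assms by (simp add: card_cartesian_product)
  next
    case (Suc i)
    then have "card (?P (Suc i)) < card (?P i)"
      using psubset_card_mono[OF fin strict[of i]] by simp
    then show ?case
      using Suc by simp
  qed
  from this[of "Suc (card W * card W)"] show False
    by simp
qed

text \<open>An edge present in layer \<open>N - i\<close> has \<open>i\<close> layers of triangles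
  above it, and their images let its image survive \<open>i\<close> rounds of pruning.\<close>

lemma hom_into_pruned:
  assumes G: "\<And>i. extends (G i) (G (Suc i))"
    "\<And>i q. q \<in> requests k (G i) \<Longrightarrow> has_triangle (G (Suc i)) q"
    and f: "f ` fst (G N) \<subseteq> W"
      "\<And>x y. x \<in> fst (G N) \<Longrightarrow> y \<in> fst (G N) \<Longrightarrow> snd (G N) x y \<noteq> 0 \<Longrightarrow> d (f x) (f y) = snd (G N) x y"
    and xy: "i \<le> N" "x \<in> fst (G (N - i))" "y \<in> fst (G (N - i))" "snd (G (N - i)) x y \<noteq> 0"
  shows "(f x, f y) \<in> pruned k W d i"
proof -
  have ext: "extends (G i) (G j)" if "i \<le> j" for i j
    using that by (induct rule: dec_induct) (use extends_refl extends_trans G(1) in blast)+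
  have pres: "f x \<in> W \<and> f y \<in> W \<and> d (f x) (f y) = snd (G i) x y"
    if "i \<le> N" "x \<in> fst (G i)" "y \<in> fst (G i)" "snd (G i) x y \<noteq> 0" for i x y
  proof -
    have "x \<in> fst (G N)" "y \<in> fst (G N)" "snd (G N) x y = snd (G i) x y"
      using ext[OF that(1)] that by (auto simp: extends_def)
    then show ?thesis
      using f that(4) by auto
  qed
  show ?thesis
    using xy
  proof (induct i arbitrary: x y)
    case 0
    then show ?case
      using pres[of N x y] by simp
  next
    case (Suc i)
    let ?H = "G (N - Suc i)" and ?H' = "G (N - i)"
    have step: "N - i = Suc (N - Suc i)"
      using Suc by simp
    have "extends ?H ?H'"
      using G(1)[of "N - Suc i"] step by simp
    then have up: "x \<in> fst ?H'" "y \<in> fst ?H'" "snd ?H' x y \<noteq> 0"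
      using Suc by (auto simp: extends_def)
    moreover have "\<exists>w. (f x, w) \<in> pruned k W d i \<and> (f y, w) \<in> pruned k W d i \<and> d (f x) w = a \<and> d (f y) w = b"
      if ab: "a \<in> {1..k}" "b \<in> {1..k}" for a b
    proof -
      have "(x, y, a, b) \<in> requests k ?H"
        using Suc ab by (simp add: requests_def)
      then have "has_triangle ?H' (x, y, a, b)"
        using G(2) step by simp
      then obtain w where w: "w \<in> fst ?H'" "snd ?H' x w = a" "snd ?H' y w = b"
        by (auto simp: has_triangle_def)
      then have "(f x, f w) \<in> pruned k W d i" "(f y, f w) \<in> pruned k W d i"
        using Suc up ab by auto
      moreover have "d (f x) (f w) = a" "d (f y) (f w) = b"
        using pres[of "N - i" x w] pres[of "N - i" y w] up w ab by auto
      ultimately show ?thesis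
        by blast
    qed
    ultimately show ?case
      using Suc by simp
  qed
qed

text \<open>The linear order on vertices serves to single out the least vertex of a triangle in
  \<open>extremal_dvd\<close>.\<close>

locale closed_edges =
  fixes n m :: nat and W :: "'b :: linorder set" and d :: "'b \<Rightarrow> 'b \<Rightarrow> nat" and E :: "'b rel"
  assumes col: "colouring n m W d"
    and E: "E \<subseteq> {(x, y) \<in> W \<times> W. d x y \<noteq> 0}"
    and closed: "\<And>x y a b. (x, y) \<in> E \<Longrightarrow> a \<in> {1..2 * n + m} \<Longrightarrow> b \<in> {1..2 * n + m} \<Longrightarrow>
      \<exists>w. (x, w) \<in> E \<and> (y, w) \<in> E \<and> d x w = a \<and> d y w = b"
begin

abbreviation "k \<equiv> 2 * n + m"

definition nbs :: "nat \<Rightarrow> 'b \<Rightarrow> 'b set" where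
  "nbs a x = {w. (x, w) \<in> E \<and> d x w = a}"

lemma finite_nbs: "finite (nbs a x)"
  using colouringD(1)[OF col] E by (auto simp: nbs_def intro: finite_subset[of _ W])

text \<open>Closure on the edge \<open>xu\<close> gives a vertex \<open>g b\<close> for each label
  \<open>b\<close> at \<open>u\<close>. Different labels force different vertices, and none is
  \<open>u\<close> because \<open>d u u = 0\<close>.\<close>

lemma nbs_in_nbs:
  assumes "u \<in> nbs a x" "a \<in> {1..k}"
  obtains g where "inj_on g {1..k}" "g ` {1..k} \<subseteq> nbs a x - {u}" "\<And>b. b \<in> {1..k} \<Longrightarrow> d u (g b) = b"
proof -
  have xu: "(x, u) \<in> E" "u \<in> W"
    using assms E by (auto simp: nbs_def)
  then have "\<forall>b\<in>{1..k}. \<exists>w. (x, w) \<in> E \<and> (u, w) \<in> E \<and> d x w = a \<and> d u w = b"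
    using closed assms by blast
  then obtain g where g: "\<And>b. b \<in> {1..k} \<Longrightarrow> (x, g b) \<in> E \<and> d x (g b) = a \<and> d u (g b) = b"
    by metis
  have "g b \<in> nbs a x - {u}" if "b \<in> {1..k}" for b
    using g[OF that] colouringD(2)[OF col xu(2)] that by (auto simp: nbs_def)
  then have "g ` {1..k} \<subseteq> nbs a x - {u}"
    by blast
  moreover have "inj_on g {1..k}"
    using g by (intro inj_on_inverseI[of _ "d u"]) blast
  ultimately show ?thesis
    using that g by blast
qed

text \<open>A neighbour \<open>u\<close> of type \<open>a\<close> counts together with the
  \<open>k\<close> others from \<open>nbs_in_nbs\<close>.\<close>

lemma card_nbs_ge:
  assumes "(x, y) \<in> E" "a \<in> {1..k}"
  shows "k + 1 \<le> card (nbs a x)"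
proof -
  obtain u where u: "u \<in> nbs a x"
    using closed[OF assms(1,2,2)] by (auto simp: nbs_def)
  then obtain g where "inj_on g {1..k}" "g ` {1..k} \<subseteq> nbs a x - {u}"
    using nbs_in_nbs assms(2) by metis
  then have "k \<le> card (nbs a x - {u})"
    using card_inj_on_le[of g "{1..k}" "nbs a x - {u}"] finite_nbs by simp
  moreover have "card (nbs a x) > 0"
    using u finite_nbs by (auto simp: card_gt_0_iff)
  ultimately show ?thesis
    using u finite_nbs by simp
qed

lemma Union_nbs_subset: "x \<in> W \<Longrightarrow> (\<Union>a\<in>{1..k}. nbs a x) \<subseteq> W - {x}"
  using E colouringD(2)[OF col] by (auto simp: nbs_def)

lemma card_Union_nbs: "card (\<Union>a\<in>{1..k}. nbs a x) = (\<Sum>a\<in>{1..k}. card (nbs a x))"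
  by (rule card_UN_disjoint) (auto simp: finite_nbs, auto simp: nbs_def)

text \<open>The \<open>k\<close> classes of neighbours of \<open>x\<close> are disjoint and miss
  \<open>x\<close> itself.\<close>

lemma card_ge:
  assumes "(x, y) \<in> E"
  shows "k * (k + 1) + 1 \<le> card W"
proof -
  have xW: "x \<in> W" and finW: "finite W"
    using assms E colouringD(1)[OF col] by auto
  have "k * (k + 1) \<le> (\<Sum>a\<in>{1..k}. card (nbs a x))"
    using sum_bounded_below[of "{1..k}" "k + 1" "\<lambda>a. card (nbs a x)"] card_nbs_ge[OF assms] by simp
  also have "\<dots> \<le> card (W - {x})"
    using card_mono[OF _ Union_nbs_subset[OF xW]] finW card_Union_nbs by simp
  also have "\<dots> = card W - 1"
    using xW finW by simp
  finally show ?thesis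
    using xW finW by (metis One_nat_def Suc_eq_plus1 Suc_le_mono Suc_pred card_gt_0_iff empty_iff)
qed

text \<open>Equality in \<open>card_ge\<close> makes every estimate tight at each vertex where an
  edge of \<open>E\<close> starts: each class has \<open>k + 1\<close> elements, and together they
  exhaust \<open>W - {x}\<close>.\<close>

lemma extremal:
  assumes E0: "E \<noteq> {}" and card: "card W = k * (k + 1) + 1" and k: "k \<ge> 1"
  shows "\<And>x a. x \<in> W \<Longrightarrow> a \<in> {1..k} \<Longrightarrow> card (nbs a x) = k + 1"
    and "E = {(x, y) \<in> W \<times> W. x \<noteq> y}"
proof -
  have finW: "finite W"
    using colouringD(1)[OF col] .
  have local: "(\<Union>a\<in>{1..k}. nbs a x) = W - {x} \<and> (\<forall>a\<in>{1..k}. card (nbs a x) = k + 1)"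
    if xy: "(x, y) \<in> E" for x y
  proof -
    have xW: "x \<in> W"
      using xy E by auto
    have total: "card (W - {x}) = k * (k + 1)"
      using card xW finW by simp
    have le: "(\<Sum>a\<in>{1..k}. card (nbs a x)) \<le> k * (k + 1)"
      using card_mono[OF _ Union_nbs_subset[OF xW]] finW card_Union_nbs total by simp
    have each: "card (nbs a x) = k + 1" if a: "a \<in> {1..k}" for a
    proof (rule ccontr)
      assume "card (nbs a x) \<noteq> k + 1"
      then have "k + 1 < card (nbs a x)"
        using card_nbs_ge[OF xy a] by simp
      then have "(\<Sum>a\<in>{1..k}. k + 1) < (\<Sum>a\<in>{1..k}. card (nbs a x))"
        using card_nbs_ge[OF xy] a by (intro sum_strict_mono_ex1 ballI bexI[of _ a]) simp_all
      then show False
        using le by simp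
    qed
    then have "card (\<Union>a\<in>{1..k}. nbs a x) = card (W - {x})"
      using card_Union_nbs total by simp
    then show ?thesis
      using card_subset_eq[OF _ Union_nbs_subset[OF xW]] finW each by auto
  qed
  have all: "\<exists>y. (x, y) \<in> E" if "x \<in> W" for x
  proof -
    obtain z y where zy: "(z, y) \<in> E"
      using E0 by auto
    show ?thesis
    proof (cases "x = z")
      case False
      then have "x \<in> (\<Union>a\<in>{1..k}. nbs a z)"
        using local[OF zy] that by blast
      then have "(z, x) \<in> E"
        by (auto simp: nbs_def)
      then show ?thesis
        \<comment> \<open>The triangle on the edge \<open>zx\<close> supplies an edge of
          \<open>E\<close> starting at \<open>x\<close>.\<close>
        using closed[of z x 1 1] k by auto
    qed (use zy in auto)
  qed
  show "card (nbs a x) = k + 1" if "x \<in> W" "a \<in> {1..k}" for x a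
    using local all that by blast
  have "(x, y) \<in> E" if "x \<in> W" "y \<in> W" "x \<noteq> y" for x y
  proof -
    obtain z where "(x, z) \<in> E"
      using all \<open>x \<in> W\<close> by blast
    then have "y \<in> (\<Union>a\<in>{1..k}. nbs a x)"
      using local that(2,3) by simp
    then show ?thesis
      by (auto simp: nbs_def)
  qed
  moreover have "x \<noteq> y" if "(x, y) \<in> E" for x y
    using that E colouringD(2)[OF col] by auto
  ultimately show "E = {(x, y) \<in> W \<times> W. x \<noteq> y}"
    using E by auto
qed

text \<open>Both sides count ordered triangles with all labels \<open>a\<close>. Each first vertex
  has \<open>k + 1\<close> choices for the second, and the third is then unique; rotation splits the
  triangles into three equally large classes.\<close>

lemma extremal_dvd:
  assumes E0: "E \<noteq> {}" and card: "card W = k * (k + 1) + 1"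
    and a: "a \<in> {1..k}" "opp n a = a"
  shows "3 dvd (k * (k + 1) + 1) * (k + 1)"
proof -
  have k: "k \<ge> 1"
    using a by auto
  note deg = extremal(1)[OF E0 card k] and complete = extremal(2)[OF E0 card k]
  have finW: "finite W"
    using colouringD(1)[OF col] .
  have sym: "d y x = a" if "d x y = a" "x \<in> W" "y \<in> W" for x y
    using colouringD(4)[OF col that(2,3)] that(1) a(2) by simp
  have mem: "w \<in> nbs a x \<longleftrightarrow> w \<in> W \<and> d x w = a" if "x \<in> W" for x w
  proof -
    have "(x, w) \<in> E \<longleftrightarrow> w \<in> W \<and> x \<noteq> w"
      using that by (subst complete) simp
    then show ?thesis
      using a(1) colouringD(2)[OF col that] by (auto simp: nbs_def)
  qed
  \<comment> \<open>By tightness the injection \<open>g\<close> is onto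
    \<open>nbs a x - {u}\<close>, so exactly one element there, namely \<open>g a\<close>, has label
    \<open>a\<close> at \<open>u\<close>.\<close>
  have uniq: "card {w \<in> nbs a x. d u w = a} = 1" if x: "x \<in> W" and u: "u \<in> nbs a x" for x u
  proof -
    obtain g where g: "inj_on g {1..k}" "g ` {1..k} \<subseteq> nbs a x - {u}" "\<And>b. b \<in> {1..k} \<Longrightarrow> d u (g b) = b"
      by (rule nbs_in_nbs[OF u a(1)]) blast
    have "card (g ` {1..k}) = card (nbs a x - {u})"
      using g(1) deg[OF x a(1)] u finite_nbs by (simp add: card_image)
    then have im: "g ` {1..k} = nbs a x - {u}"
      using card_subset_eq[OF _ g(2)] finite_nbs by simp
    have "u \<in> W"
      using u mem[OF x] by blast
    then have "d u u \<noteq> a"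
      using a(1) colouringD(2)[OF col] by simp
    then have "{w \<in> nbs a x. d u w = a} = {w \<in> g ` {1..k}. d u w = a}"
      unfolding im by auto
    also have "\<dots> = {g a}"
      using g(3) a(1) by force
    finally show ?thesis
      by simp
  qed
  define Tri where "Tri = (SIGMA x:W. SIGMA u:nbs a x. {w \<in> nbs a x. d u w = a})"
  have "card Tri = (\<Sum>x\<in>W. \<Sum>u\<in>nbs a x. card {w \<in> nbs a x. d u w = a})"
    unfolding Tri_def using finW finite_nbs by (subst card_SigmaI; simp)+
  also have "\<dots> = (\<Sum>x\<in>W. \<Sum>u\<in>nbs a x. 1)"
    using uniq by simp
  also have "\<dots> = (k * (k + 1) + 1) * (k + 1)"
    using deg[OF _ a(1)] card by simp
  finally have cardTri: "card Tri = (k * (k + 1) + 1) * (k + 1)" .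
  have Tri_iff: "(x, u, w) \<in> Tri \<longleftrightarrow> x \<in> W \<and> u \<in> W \<and> w \<in> W \<and> d x u = a \<and> d x w = a \<and> d u w = a" for x u w
    unfolding Tri_def using mem by auto
  \<comment> \<open>The three classes are distinguished by the position of the least vertex.
    Rotation preserves \<open>Tri\<close> because \<open>a\<close> is its own opposite.\<close>
  let ?rot = "\<lambda>(x, u, w). (u, w, x)"
  let ?A = "{(x, u, w) \<in> Tri. x < u \<and> x < w}"
  let ?B = "{(x, u, w) \<in> Tri. u < x \<and> u < w}"
  let ?C = "{(x, u, w) \<in> Tri. w < x \<and> w < u}"
  have ne: "x \<noteq> u \<and> x \<noteq> w \<and> u \<noteq> w" if "(x, u, w) \<in> Tri" for x u w
    using that a(1) colouringD(2)[OF col] unfolding Tri_iff by auto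
  have finTri: "finite Tri"
    unfolding Tri_def using finW finite_nbs by auto
  have rot: "(u, w, x) \<in> Tri" "(w, x, u) \<in> Tri" if "(x, u, w) \<in> Tri" for x u w
    using that sym unfolding Tri_iff by blast+
  let ?rot' = "\<lambda>(x, u, w). (w, x, u)"
  have fwd: "?rot \<in> ?B \<rightarrow> ?A" "?rot \<in> ?C \<rightarrow> ?B"
    by (clarsimp simp: rot(1))+
  have bwd: "?rot' \<in> ?A \<rightarrow> ?B" "?rot' \<in> ?B \<rightarrow> ?C"
    by (clarsimp simp: rot(2))+
  have "bij_betw ?rot ?B ?A" "bij_betw ?rot ?C ?B"
    using bij_betwI[OF fwd(1) bwd(1)] bij_betwI[OF fwd(2) bwd(2)] by (simp_all add: split_def)
  then have "card ?B = card ?A" "card ?C = card ?B"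
    using bij_betw_same_card by blast+
  moreover have "t \<in> ?A \<union> ?B \<union> ?C" if t: "t \<in> Tri" for t
  proof -
    obtain x u w where xuw: "t = (x, u, w)"
      by (cases t)
    have "x \<noteq> u" "x \<noteq> w" "u \<noteq> w"
      using ne[of x u w] t xuw by blast+
    then have "x < u \<and> x < w \<or> u < x \<and> u < w \<or> w < x \<and> w < u"
      by (metis linorder_neqE order.strict_trans)
    then show ?thesis
      using t by (simp add: xuw)
  qed
  then have "Tri = ?A \<union> ?B \<union> ?C"
    by blast
  moreover have "card (?A \<union> ?B \<union> ?C) = card ?A + card ?B + card ?C"
    using finTri by (subst card_Un_disjoint; (auto intro: finite_subset[OF _ finTri])?)+
  ultimately have "card Tri = 3 * card ?A"
    by simp
  then show ?thesis
    using cardTri by simp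
qed

end


section \<open>Targets on 15 and 21 vertices\<close>

text \<open>
  \<open>GF(4)\<close> is \<open>{0, 1, 2, 3}\<close>, where \<open>a > 0\<close> is the power \<open>a - 1\<close> of a generator of the multiplicative
  group. Vertex \<open>x < 15\<close> is the vector with coordinates \<open>(x + 1) div 4\<close> and \<open>(x + 1) mod 4\<close>. In
  characteristic 2 the determinant is symmetric, and \<open>w\<close> is determined by its determinants with two
  independent vectors, which gives the required triangles.
\<close>

definition gf4_add :: "nat \<Rightarrow> nat \<Rightarrow> nat" where
  "gf4_add a b = (if a = 0 then b else if b = 0 then a else if a = b then 0 else 6 - a - b)"

text \<open>The exponents \<open>a - 1\<close> and \<open>b - 1\<close> add up to
  \<open>a + b - 2\<close>, congruent to \<open>a + b + 1\<close> modulo 3. In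
  \<open>gf4_add\<close>, two distinct nonzero elements sum to the third one, and 1 + 2 + 3 =
  6.\<close>

definition gf4_mult :: "nat \<Rightarrow> nat \<Rightarrow> nat" where
  "gf4_mult a b = (if a = 0 \<or> b = 0 then 0 else Suc ((a + b + 1) mod 3))"

definition gf4_det :: "nat \<Rightarrow> nat \<Rightarrow> nat" where
  "gf4_det x y = gf4_add (gf4_mult (Suc x div 4) (Suc y mod 4)) (gf4_mult (Suc x mod 4) (Suc y div 4))"

text \<open>
  Vertex \<open>7 * i + a\<close> is the pair \<open>(i, a)\<close> in \<open>\<int>\<^sub>3 \<times> \<int>\<^sub>7\<close>. The labelling is invariant under
  \<open>(i, a) \<mapsto> (i, a + 1)\<close> and \<open>(i, a) \<mapsto> (i + 1, 2 * a)\<close>, hence given by its row at \<open>(0, 0)\<close>, which was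
  found by a computer search; \<open>4\<close> is the inverse of \<open>2\<close> modulo \<open>7\<close>.
\<close>

definition cayley21 :: "nat \<Rightarrow> nat \<Rightarrow> nat" where
  "cayley21 x y =
     [0, 3, 2, 3, 3, 1, 3,
      3, 2, 2, 2, 1, 1, 1,
      3, 2, 1, 1, 2, 2, 1] !
     (7 * ((y div 7 + 3 - x div 7) mod 3) + (y mod 7 + 7 - x mod 7) * 4 ^ (x div 7) mod 7)"

text \<open>An executable form of the target conditions for \<open>2 * n + m = 3\<close>. A column
  where rows \<open>x\<close> and \<open>y\<close> show the pair \<open>(a, b)\<close> is a common
  neighbour of these types.\<close>

definition good_row :: "nat \<Rightarrow> nat list list \<Rightarrow> nat \<Rightarrow> bool" where
  "good_row n T x \<longleftrightarrow>
     list_all (\<lambda>y.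
       let a = T ! x ! y in
       a \<le> 3 \<and> T ! y ! x = opp n a \<and>
       (a = 0 \<or> (let ps = zip (T ! x) (T ! y) in
         list_all (\<lambda>p. p \<in> set ps) (List.product [1, 2, 3] [1, 2, 3]))))
     [0..<length T] \<and>
     T ! x ! x = 0 \<and> list_ex (\<lambda>a. a \<noteq> 0) (T ! x)"

section \<open>Evaluation of the two targets\<close>

lemma good_gf4: "list_all (good_row 0 (map (\<lambda>x. map (gf4_det x) [0..<15]) [0..<15])) [0..<15]"
  by code_simp

lemma good_cayley21: "list_all (good_row 1 (map (\<lambda>x. map (cayley21 x) [0..<21]) [0..<21])) [0..<21]"
  by code_simp

lemma extension_target_table:
  assumes nm: "2 * n + m = 3" and N: "N > 0"
    and good: "list_all (good_row n (map (\<lambda>x. map (d x) [0..<N]) [0..<N])) [0..<N]"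
  shows "extension_target n m {..<N} d"
proof -
  have row: "good_row n (map (\<lambda>x. map (d x) [0..<N]) [0..<N]) x" if "x < N" for x
    using good that by (auto simp: list_all_iff)
  have zip: "zip (map (d x) [0..<N]) (map (d y) [0..<N]) = map (\<lambda>w. (d x w, d y w)) [0..<N]" for x y
    by (simp add: zip_map_map zip_same_conv_map)
  have entry: "d x y \<le> 3 \<and> d y x = opp n (d x y) \<and>
      (d x y \<noteq> 0 \<longrightarrow> (\<forall>a\<in>{1, 2, 3}. \<forall>b\<in>{1, 2, 3}. \<exists>w<N. d x w = a \<and> d y w = b))"
    if "x < N" "y < N" for x y
  proof -
    have "d x y \<le> 3 \<and> d y x = opp n (d x y) \<and>
        (d x y = 0 \<or> (\<forall>p\<in>{1, 2, 3} \<times> {1, 2, 3}. p \<in> (\<lambda>w. (d x w, d y w)) ` {0..<N}))"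
      using row[OF that(1)] that
      unfolding good_row_def list_all_iff Let_def by (simp add: zip del: insert_Times_insert)
    then show ?thesis
      by fastforce
  qed
  have loop: "d x x = 0 \<and> (\<exists>y<N. d x y \<noteq> 0)" if "x < N" for x
    using row[OF that] that by (auto simp: good_row_def list_ex_iff)
  have three: "{1..3} = {1, 2, 3 :: nat}"
    by auto
  show ?thesis
  proof
    show "colouring n m {..<N} d"
      unfolding colouring_def nm
    proof (intro conjI ballI)
      fix x y
      assume "x \<in> {..<N}" "y \<in> {..<N}"
      then show "d x y \<le> 3" "d y x = opp n (d x y)"
        using entry[of x y] by simp_all
    qed (use loop in simp_all)
    show "triangle_complete (2 * n + m) {..<N} d"
      unfolding triangle_complete_def nm three
    proof (intro ballI impI)
      fix x y a b
      assume "x \<in> {..<N}" "y \<in> {..<N}" "d x y \<noteq> 0" "a \<in> {1, 2, 3 :: nat}" "b \<in> {1, 2, 3 :: nat}"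
      then have "\<exists>w<N. d x w = a \<and> d y w = b"
        using entry[of x y] by (meson lessThan_iff)
      then show "\<exists>w\<in>{..<N}. d x w = a \<and> d y w = b"
        by auto
    qed
    show "{..<N} \<noteq> {}"
      using N by auto
    show "\<exists>y\<in>{..<N}. d x y \<noteq> 0" if "x \<in> {..<N}" for x
      using loop that by auto
  qed
qed



section \<open>The bounds\<close>

lemma treewidth_le_2_iff:
  assumes S: "pair_graph S"
  shows "treewidth S \<le> 2 \<longleftrightarrow> partial_2_tree S"
proof -
  let ?P = "\<lambda>w. \<exists>(T :: nat pair_pre_digraph) B. tree_decomposition S T B \<and> w = decomposition_width T B"
  have width_iff: "decomposition_width T B \<le> 2 \<longleftrightarrow> (\<forall>t\<in>pverts T. card (B t) \<le> 3)"
    if "tree_decomposition S T B" for T :: "nat pair_pre_digraph" and B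
  proof -
    have "finite (pverts T)" "pverts T \<noteq> {}"
      using that by (auto simp: tree_decomposition_iff tree_graph_iff pair_graph_iff connected_in_def)
    then have "Max ((\<lambda>t. card (B t)) ` pverts T) \<le> 3 \<longleftrightarrow> (\<forall>t\<in>pverts T. card (B t) \<le> 3)"
      by (subst Max_le_iff) auto
    then show ?thesis
      by (simp add: decomposition_width_def le_diff_conv)
  qed
  show ?thesis
  proof
    assume "treewidth S \<le> 2"
    moreover have "Ex ?P"
      \<comment> \<open>The decomposition into a single bag ensures that the minimum defining the
        treewidth is attained.\<close>
      using tree_decomposition_singleton[OF S, of 0] by blast
    then have "?P (treewidth S)"
      unfolding treewidth_def by (rule LeastI_ex)
    ultimately show "partial_2_tree S"
      unfolding partial_2_tree_def using width_iff by metis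
  next
    assume "partial_2_tree S"
    then obtain T :: "nat pair_pre_digraph" and B
      where TB: "tree_decomposition S T B" "\<forall>t\<in>pverts T. card (B t) \<le> 3"
      unfolding partial_2_tree_def by blast
    then have "treewidth S \<le> decomposition_width T B"
      unfolding treewidth_def by (intro Least_le) blast
    then show "treewidth S \<le> 2"
      using TB width_iff by (meson order_trans)
  qed
qed

lemma partial_2_trees_iff: "S \<in> partial_2_trees \<longleftrightarrow> pair_graph S \<and> partial_2_tree S"
  using treewidth_le_2_iff by (auto simp: partial_2_trees_def)

section \<open>From targets and coloured 2-trees to chromatic numbers\<close>

lemma chi_family_le:
  fixes d :: "nat \<Rightarrow> nat \<Rightarrow> nat"
  assumes "extension_target n m {..<N} d" "2 * n + m \<ge> 1"
  shows "chi_family n m partial_2_trees \<le> enat N"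
proof -
  interpret extension_target n m "{..<N}" d
    by fact
  have "chi n m G \<le> N" if G: "is_nm_graph n m G" "und G \<in> partial_2_trees" for G :: "nat nm_graph"
  proof -
    obtain c where c: "colouring n m (nm_verts G) c" "G = graph_of n m (nm_verts G) c"
      using graph_of_exhaust[OF G(1)] .
    obtain T :: "nat pair_pre_digraph" and B where
      "tree_decomposition (und G) T B" "\<forall>t\<in>pverts T. card (B t) \<le> 3"
      using G(2) unfolding partial_2_trees_iff partial_2_tree_def by blast
    then have "\<exists>f. nm_hom G (graph_of n m {..<N} d) f"
      using hom_to_target[OF assms(2) c(1)] c(2) by metis
    moreover have "is_nm_graph n m (graph_of n m {..<N} d)"
      by (rule is_nm_graph_graph_of[OF colouring_target])
    moreover have "card (nm_verts (graph_of n m {..<N} d)) = N"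
      by simp
    ultimately show ?thesis
      unfolding chi_def by (intro Least_le) blast
  qed
  then show ?thesis
    unfolding chi_family_def chi_simple_def by (auto intro!: SUP_least)
qed

lemma chi_family_ge:
  fixes V :: "nat set"
  assumes "coloured_2_tree n m V c"
    and "\<And>(W :: nat set) d f. colouring n m W d \<Longrightarrow> nm_hom (graph_of n m V c) (graph_of n m W d) f \<Longrightarrow> N \<le> card W"
  shows "enat N \<le> chi_family n m partial_2_trees"
proof -
  let ?G = "graph_of n m V c"
  let ?P = "\<lambda>k. \<exists>H :: nat nm_graph. is_nm_graph n m H \<and> (\<exists>f. nm_hom ?G H f) \<and> card (nm_verts H) = k"
  have G: "is_nm_graph n m ?G" and p2: "partial_2_tree (und ?G)"
    using assms(1) is_nm_graph_graph_of by (auto simp: coloured_2_tree_def)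
  \<comment> \<open>The graph is a target for itself, so the minimum in \<open>chi\<close> is
    attained by some \<open>H\<close>, to which the assumption applies.\<close>
  have "nm_hom ?G ?G id"
    by (auto simp: nm_hom_def)
  then have "?P (card (nm_verts ?G))"
    using G by blast
  then have "?P (chi n m ?G)"
    unfolding chi_def by (rule LeastI)
  then obtain H :: "nat nm_graph" and f where H: "is_nm_graph n m H" "nm_hom ?G H f" "card (nm_verts H) = chi n m ?G"
    by blast
  obtain d where "colouring n m (nm_verts H) d" "H = graph_of n m (nm_verts H) d"
    using graph_of_exhaust[OF H(1)] .
  then have "N \<le> chi n m ?G"
    using assms(2) H(2,3) by metis
  then have "enat N \<le> enat (chi n m ?G)"
    by simp
  also have "\<dots> \<le> chi_simple n m (und ?G)"
    unfolding chi_simple_def using G by (intro SUP_upper) simp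
  also have "\<dots> \<le> chi_family n m partial_2_trees"
    unfolding chi_family_def using pair_graph_und[OF G] p2
    by (intro SUP_upper) (simp add: partial_2_trees_iff)
  finally show ?thesis .
qed

lemma chi_family_ge_14:
  assumes nm: "2 * n + m = 3"
  shows "14 \<le> chi_family n m partial_2_trees"
proof -
  obtain G :: "nat \<Rightarrow> nat set \<times> (nat \<Rightarrow> nat \<Rightarrow> nat)" where
    G: "\<And>i. coloured_2_tree n m (fst (G i)) (snd (G i))"
      "\<And>i. extends (G i) (G (Suc i))"
      "\<And>i q. q \<in> requests (2 * n + m) (G i) \<Longrightarrow> has_triangle (G (Suc i)) q"
      "\<exists>u\<in>fst (G 0). \<exists>v\<in>fst (G 0). snd (G 0) u v \<noteq> 0"
    using coloured_2_tree_sequence[of n m] nm by auto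
  \<comment> \<open>A target with at most 13 vertices becomes stable under pruning within this many
    rounds, so this many layers suffice.\<close>
  let ?K = "13 * 13 :: nat"
  let ?V = "fst (G ?K)" and ?c = "snd (G ?K)"
  have "14 \<le> card W"
    if d: "colouring n m W d" and f: "nm_hom (graph_of n m ?V ?c) (graph_of n m W d) f" for W :: "nat set" and d f
  proof (rule ccontr)
    assume "\<not> 14 \<le> card W"
    then have small: "card W \<le> 13"
      by simp
    have "colouring n m ?V ?c"
      using G(1) by (simp add: coloured_2_tree_def)
    then have hom: "f ` ?V \<subseteq> W" "\<And>x y. x \<in> ?V \<Longrightarrow> y \<in> ?V \<Longrightarrow> ?c x y \<noteq> 0 \<Longrightarrow> d (f x) (f y) = ?c x y"
      using f nm_hom_graph_of_iff d by blast+
    let ?E = "pruned (2 * n + m) W d"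
    obtain i where i: "i \<le> card W * card W" "?E (Suc i) = ?E i"
      using pruned_stable[OF colouringD(1)[OF d]] by blast
    have "i \<le> ?K"
      using i(1) mult_le_mono[OF small small] by linarith
    moreover obtain u v where "u \<in> fst (G 0)" "v \<in> fst (G 0)" "snd (G 0) u v \<noteq> 0"
      using G(4) by blast
    \<comment> \<open>The initial edge has all \<open>?K\<close> layers above it, hence its image
      survives and the stable set is nonempty.\<close>
    then have "(f u, f v) \<in> ?E ?K"
      using hom_into_pruned[where G = G and N = ?K and i = ?K, OF G(2,3) hom] by simp
    ultimately have uv: "(f u, f v) \<in> ?E i"
      using pruned_antimono by blast
    interpret closed_edges n m W d "?E i"
    proof
      show "colouring n m W d"
        by (fact d)
      show "?E i \<subseteq> {(x, y) \<in> W \<times> W. d x y \<noteq> 0}"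
        using pruned_antimono[of 0 i "2 * n + m" W d] by simp
      show "\<exists>w. (x, w) \<in> ?E i \<and> (y, w) \<in> ?E i \<and> d x w = a \<and> d y w = b"
        if "(x, y) \<in> ?E i" "a \<in> {1..2 * n + m}" "b \<in> {1..2 * n + m}" for x y a b
      proof -
        have "(x, y) \<in> ?E (Suc i)"
          using that(1) i(2) by simp
        then show ?thesis
          using that(2,3) by simp
      qed
    qed
    have "card W = (2 * n + m) * (2 * n + m + 1) + 1"
      using card_ge[OF uv] small unfolding nm by simp
    \<comment> \<open>By parity \<open>2 * n\<close> is not 3, so 3 is an undirected edge type and
      its own opposite, as \<open>extremal_dvd\<close> requires.\<close>
    moreover have "2 * n < 3"
      using nm by presburger
    then have "opp n 3 = 3"
      by (simp add: opp_def)
    ultimately have "3 dvd (3 * (3 + 1) + 1) * (3 + 1 :: nat)"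
      using extremal_dvd[of 3] uv unfolding nm by auto
    then show False
      by simp
  qed
  then have "enat 14 \<le> chi_family n m partial_2_trees"
    by (rule chi_family_ge[OF G(1)])
  then show ?thesis
    by (simp add: numeral_eq_enat)
qed

theorem theorem4p1:
  shows "(14 \<le> chi_family 0 3 partial_2_trees \<and> chi_family 0 3 partial_2_trees \<le> 15) \<and>
         (14 \<le> chi_family 1 1 partial_2_trees \<and> chi_family 1 1 partial_2_trees \<le> 21)"
proof -
  have "chi_family 0 3 partial_2_trees \<le> enat 15"
    by (intro chi_family_le[OF extension_target_table[OF _ _ good_gf4]]) simp_all
  moreover have "chi_family 1 1 partial_2_trees \<le> enat 21"
    by (intro chi_family_le[OF extension_target_table[OF _ _ good_cayley21]]) simp_all
  ultimately show ?thesis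
    using chi_family_ge_14[of 0 3] chi_family_ge_14[of 1 1] by (simp add: numeral_eq_enat)
qed

end
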